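(* Let $\kappa\ge1$, $\gamma\in(0,1)$, $W,G,\mu>0$, assume $\mathcal K_{\kappa,\gamma}\neq\varnothing$, and let $K_0$ be a tracking gain with $\Lambda(K_0)<\infty$. Put $d_K=d_ud_x$, $R_K=\kappa\sqrt{\min\{d_x,d_u\}}$, and $$X_\gamma=\frac{\kappa^2W}{\gamma},\quad D_{\rm sc}=\left(\sqrt{1+\kappa^2}+2\Lambda(K_0)\right)X_\gamma,\quad L=GD_{\rm sc},$$ $$L_{\mathcal K}=\frac{\kappa^2W}{\gamma}+\frac{(1+\kappa)\kappa^4\|B\|_{\rm op}W}{\gamma^2},\qquad \mathfrak A_{\rm sc}=\frac{L^2}{\mu}\bigl(1+\Lambda(K_0)B_+\bigr).$$ Suppose the costs are $(G,D_{\rm sc})$-regular and $\mu$-strongly convex on the radius-$D_{\rm sc}$ ball. Then there is a counterfactual-tracking algorithm based on a finite cover of $\mathcal K_{\kappa,\gamma}$ such that, with a universal constant $C$, $$\mathrm{Reg}_T(\mathcal K_{\kappa,\gamma})\le C\,\mathfrak A_{\rm sc}\,d_K\log\!\left(4+\frac{2R_KTLL_{\mathcal K}}{\mathfrak A_{\rm sc}d_K}\right).$$ If moreover $K_0$ satisfies $\max\{1,\Lambda(K_0),\Lambda_B(K_0)\}\le2\,\mathfrak C(A,B)$, then $$\mathrm{Reg}_T(\mathcal K_{\kappa,\gamma})\le C_{\rm sys}\frac{G^2W^2}{\mu\gamma^2}\,d_K\log\!\left(4+\frac{C_{\rm sys}\mu T}{Gd_K\gamma}\right),$$ where $C_{\rm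 sys}$ depends only on $d_x,d_u,\kappa$ and $\mathfrak C(A,B)$ (not on $T,W,\gamma,G,\mu$).
   Context: Model: $A\in\mathbb R^{d_x\times d_x}$, $B\in\mathbb R^{d_x\times d_u}$ are known; $x_1=0$ and $x_{t+1}=Ax_t+Bu_t+w_t$ with $\|w_t\|\le W$. On round $t=1,\dots,T$ the learner observes $x_t$, chooses $u_t$, incurs $c_t(x_t,u_t)$, then observes the whole function $c_t$ and $x_{t+1}$ (hence $w_t$). The environment may choose $c_t,w_t$ as a function of previously revealed history but not of the current action; bounds are pathwise. Write $y_t=(x_t,u_t)$; $\|\cdot\|$ Euclidean, $\|(x,u)\|^2=\|x\|^2+\|u\|^2$. Benchmark: $\mathcal K_{\kappa,\gamma}=\{K\in\mathbb R^{d_u\times d_x}:\|K\|_{\rm op}\le\kappa,\ \|(A-BK)^r\|_{\rm op}\le\kappa^2(1-\gamma)^r\ \forall r\ge0\}$; $K$ denotes the policy $u_t=-Kx_t$, and $y_t^K$ its trajectory from $x_1^K=0$ on the same realized disturbances. $\mathrm{Reg}_T(\mathcal K_{\kappa,\gamma})=\sum_{t\le T}c_t(y_t)-\inf_{K}\sum_{t\le T}c_t(y_t^K)$. Costs: a convex cost is $(G,D)$-regular if it is differentiable with $\|\nabla c_t(y)\|\le GD$ on the radius-$D$ ball; it is $\mu$-strongly convex on a convex set $\mathcal Y$ if $c_t(y')\ge c_t(y)+\langle g,y'-y\rangle+\frac\mu2\|y'-y\|^2$ for all $y,y'\in\mathcal Y$, $g\in\partial c_t(y)$. Tracker: $F_0=A-BK_0$,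 $\Lambda(K_0)=\sum_{r\ge0}\left\|\begin{bmatrix}I\\-K_0\end{bmatrix}F_0^r\right\|_{\rm op}$, $\Lambda_B(K_0)=\sum_{r\ge0}\|F_0^rB\|_{\rm op}$, $B_+=\|[A\ B]\|_{\rm op}$, $\mathfrak C(A,B)=\inf\{\max\{1,\Lambda(K),\Lambda_B(K)\}:A-BK\text{ Schur stable}\}$. Counterfactual tracking based on a finite cover: for a finite set $\mathcal N\subset\mathcal K_{\kappa,\gamma}$ and $\eta>0$, let $p_t(K)\propto\exp\{-\eta\sum_{s<t}c_s(y_s^K)\}$ on $\mathcal N$, $\bar y_t=(\bar x_t,\bar u_t)=\sum_{K\in\mathcal N}p_t(K)y_t^K$, and play $u_t=\bar u_t-K_0(x_t-\bar x_t)$. (It is causal, since past costs and disturbances are revealed.) *)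

theory Defs
  imports
    Jordan_Normal_Form.Matrix
    Jordan_Normal_Form.Spectral_Radius
    "HOL-Library.Extended_Nonnegative_Real"
begin

text \<open>
  Vectors and matrices carry their dimensions as natural numbers (rather than in their types),
  so that one universal constant can be quantified outside all dimensions.
\<close>

definition vnorm :: "real vec \<Rightarrow> real" where
  "vnorm v = sqrt (v \<bullet> v)"

definition vball :: "nat \<Rightarrow> real \<Rightarrow> real vec set" where
  "vball n D = {y \<in> carrier_vec n. vnorm y \<le> D}"

definition op_norm :: "real mat \<Rightarrow> real" where
  "op_norm M = (SUP v\<in>vball (dim_col M) 1. vnorm (M *\<^sub>v v))"

text \<open>
  Rounds are numbered from 1, with \<open>x\<^sub>1 = 0\<close>; the value at index 0 is irrelevant.
  The law \<open>\<pi> t x\<close> is the action taken in round \<open>t\<close> at state \<open>x\<close>.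
\<close>

fun rollout ::
  "real mat \<Rightarrow> real mat \<Rightarrow> (nat \<Rightarrow> real vec \<Rightarrow> real vec) \<Rightarrow> (nat \<Rightarrow> real vec) \<Rightarrow> nat \<Rightarrow> real vec" where
  "rollout A B \<pi> w 0 = 0\<^sub>v (dim_row A)"
| "rollout A B \<pi> w (Suc 0) = 0\<^sub>v (dim_row A)"
| "rollout A B \<pi> w (Suc (Suc t)) =
     A *\<^sub>v rollout A B \<pi> w (Suc t) + B *\<^sub>v \<pi> (Suc t) (rollout A B \<pi> w (Suc t)) + w (Suc t)"

definition joint ::
  "real mat \<Rightarrow> real mat \<Rightarrow> (nat \<Rightarrow> real vec \<Rightarrow> real vec) \<Rightarrow> (nat \<Rightarrow> real vec) \<Rightarrow> nat \<Rightarrow> real vec" where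
  "joint A B \<pi> w t = rollout A B \<pi> w t @\<^sub>v \<pi> t (rollout A B \<pi> w t)"

definition linear_law :: "real mat \<Rightarrow> nat \<Rightarrow> real vec \<Rightarrow> real vec" where
  "linear_law K t x = - (K *\<^sub>v x)"

definition policy_class :: "real mat \<Rightarrow> real mat \<Rightarrow> real \<Rightarrow> real \<Rightarrow> real mat set" where
  "policy_class A B \<kappa> \<gamma> =
     {K \<in> carrier_mat (dim_col B) (dim_row A). op_norm K \<le> \<kappa> \<and>
        (\<forall>r. op_norm ((A - B * K) ^\<^sub>m r) \<le> \<kappa>\<^sup>2 * (1 - \<gamma>) ^ r)}"

text \<open>
  The real infimum is over a family bounded below when the costs are regular on a ball
  containing the benchmark trajectories.
\<close>

definition regret ::
  "real mat \<Rightarrow> real mat \<Rightarrow> real mat set \<Rightarrow> (nat \<Rightarrow> real vec \<Rightarrow> real vec) \<Rightarrow>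
   (nat \<Rightarrow> real vec \<Rightarrow> real) \<Rightarrow> (nat \<Rightarrow> real vec) \<Rightarrow> nat \<Rightarrow> real" where
  "regret A B \<K> \<pi> c w T =
     (\<Sum>t\<in>{1..T}. c t (joint A B \<pi> w t))
     - (INF K\<in>\<K>. \<Sum>t\<in>{1..T}. c t (joint A B (linear_law K) w t))"

definition convex_cost :: "nat \<Rightarrow> (real vec \<Rightarrow> real) \<Rightarrow> bool" where
  "convex_cost n c \<longleftrightarrow>
     (\<forall>y\<in>carrier_vec n. \<forall>y'\<in>carrier_vec n. \<forall>a\<in>{0..1}.
        c ((1 - a) \<cdot>\<^sub>v y + a \<cdot>\<^sub>v y') \<le> (1 - a) * c y + a * c y')"

text \<open>Frechet differentiability at \<open>y\<close> with gradient \<open>g\<close>.\<close>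

definition has_gradient :: "nat \<Rightarrow> (real vec \<Rightarrow> real) \<Rightarrow> real vec \<Rightarrow> real vec \<Rightarrow> bool" where
  "has_gradient n c g y \<longleftrightarrow> g \<in> carrier_vec n \<and>
     (\<forall>e>0. \<exists>d>0. \<forall>h\<in>carrier_vec n.
        vnorm h < d \<longrightarrow> \<bar>c (y + h) - c y - g \<bullet> h\<bar> \<le> e * vnorm h)"

definition regular_cost :: "nat \<Rightarrow> real \<Rightarrow> real \<Rightarrow> (real vec \<Rightarrow> real) \<Rightarrow> bool" where
  "regular_cost n G D c \<longleftrightarrow> convex_cost n c \<and>
     (\<forall>y\<in>vball n D. \<exists>g. has_gradient n c g y \<and> vnorm g \<le> G * D)"

definition subdiff :: "nat \<Rightarrow> (real vec \<Rightarrow> real) \<Rightarrow> real vec \<Rightarrow> real vec set" where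
  "subdiff n c y = {g \<in> carrier_vec n. \<forall>z\<in>carrier_vec n. c z \<ge> c y + g \<bullet> (z - y)}"

definition strongly_convex_on :: "nat \<Rightarrow> real \<Rightarrow> real vec set \<Rightarrow> (real vec \<Rightarrow> real) \<Rightarrow> bool" where
  "strongly_convex_on n \<mu> Y c \<longleftrightarrow>
     (\<forall>y\<in>Y. \<forall>y'\<in>Y. \<forall>g\<in>subdiff n c y.
        c y' \<ge> c y + g \<bullet> (y' - y) + \<mu> / 2 * (vnorm (y' - y))\<^sup>2)"

definition Lambda :: "real mat \<Rightarrow> real mat \<Rightarrow> real mat \<Rightarrow> ennreal" where
  "Lambda A B K = (\<Sum>r. ennreal (op_norm ((1\<^sub>m (dim_row A) @\<^sub>r (- K)) * (A - B * K) ^\<^sub>m r)))"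

definition Lambda_B :: "real mat \<Rightarrow> real mat \<Rightarrow> real mat \<Rightarrow> ennreal" where
  "Lambda_B A B K = (\<Sum>r. ennreal (op_norm ((A - B * K) ^\<^sub>m r * B)))"

text \<open>The operator norm of the horizontal concatenation \<open>[A B]\<close> (the lower blocks have no rows).\<close>

definition B_plus :: "real mat \<Rightarrow> real mat \<Rightarrow> real" where
  "B_plus A B = op_norm (four_block_mat A B (0\<^sub>m 0 (dim_col A)) (0\<^sub>m 0 (dim_col B)))"

definition schur_stable :: "real mat \<Rightarrow> bool" where
  "schur_stable F \<longleftrightarrow> spectral_radius (map_mat complex_of_real F) < 1"

definition track_complexity :: "real mat \<Rightarrow> real mat \<Rightarrow> ennreal" where
  "track_complexity A B =
     (INF K\<in>{K \<in> carrier_mat (dim_col B) (dim_row A). schur_stable (A - B * K)}.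
        Max {1, Lambda A B K, Lambda_B A B K})"

definition finite_cover :: "real \<Rightarrow> real mat set \<Rightarrow> real mat set \<Rightarrow> bool" where
  "finite_cover \<epsilon> N \<K> \<longleftrightarrow> finite N \<and> N \<subseteq> \<K> \<and> (\<forall>K\<in>\<K>. \<exists>K'\<in>N. op_norm (K - K') \<le> \<epsilon>)"

text \<open>In round \<open>t\<close> everything below uses only the costs and disturbances of rounds \<open>s < t\<close>.\<close>

definition ew_weight ::
  "real mat \<Rightarrow> real mat \<Rightarrow> real mat set \<Rightarrow> real \<Rightarrow>
   (nat \<Rightarrow> real vec \<Rightarrow> real) \<Rightarrow> (nat \<Rightarrow> real vec) \<Rightarrow> nat \<Rightarrow> real mat \<Rightarrow> real" where
  "ew_weight A B N \<eta> c w t K =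
     exp (- \<eta> * (\<Sum>s\<in>{1..<t}. c s (joint A B (linear_law K) w s))) /
     (\<Sum>K'\<in>N. exp (- \<eta> * (\<Sum>s\<in>{1..<t}. c s (joint A B (linear_law K') w s))))"

definition ew_mean ::
  "real mat \<Rightarrow> real mat \<Rightarrow> real mat set \<Rightarrow> real \<Rightarrow>
   (nat \<Rightarrow> real vec \<Rightarrow> real) \<Rightarrow> (nat \<Rightarrow> real vec) \<Rightarrow> nat \<Rightarrow> real vec" where
  "ew_mean A B N \<eta> c w t =
     vec (dim_row A + dim_col B)
       (\<lambda>i. \<Sum>K\<in>N. ew_weight A B N \<eta> c w t K * joint A B (linear_law K) w t $ i)"

definition tracking_law ::
  "real mat \<Rightarrow> real mat \<Rightarrow> real mat \<Rightarrow> real mat set \<Rightarrow> real \<Rightarrow>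
   (nat \<Rightarrow> real vec \<Rightarrow> real) \<Rightarrow> (nat \<Rightarrow> real vec) \<Rightarrow> nat \<Rightarrow> real vec \<Rightarrow> real vec" where
  "tracking_law A B K0 N \<eta> c w t x =
     (let ybar = ew_mean A B N \<eta> c w t;
          xbar = vec_first ybar (dim_row A);
          ubar = vec_last ybar (dim_col B)
      in ubar - K0 *\<^sub>v (x - xbar))"

end

theory Submission
  imports Defs "HOL-Analysis.L2_Norm"
begin

text \<open>
  Exponential weights are run on the benchmark trajectories with \<open>\<eta> = 1 / (16 Asc)\<close>. In round \<open>t\<close>
  let \<open>m\<close> be the weighted mean and \<open>V\<close> the weighted variance of the trajectories. Strong
  convexity at \<open>m\<close> gives the mixture loss the slack \<open>\<mu>/4 V\<close> below the usual exp-concavity bound.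
  Since the change of the weights is centred, the mean moves in one step by only \<open>O(\<eta> L V)\<close>,
  quadratically in the spread, instead of the obvious \<open>O(\<eta> L)\<close> times the diameter. Hence the
  tracking error, filtered through the stable loop \<open>A - B K0\<close>, costs at most
  \<open>4 \<eta> L\<^sup>2 \<Lambda> B\<^sub>+ \<Sum> V\<close>, which the slack pays for in full. What remains is \<open>ln card N / \<eta>\<close>
  plus the discretisation error \<open>T L LK \<epsilon>\<close>, and \<open>\<epsilon>\<close> balances the two.
\<close>

subsection \<open>Euclidean and operator norms\<close>

text \<open>Gradient bounds and strong convexity hold only on the ball of radius \<open>D\<close>,
  so the played trajectory must be confined to it before its cost can be compared with that of the
  mean. The residual, the amount by which the mean trajectory violates the dynamics, is therefore
  bounded twice. Crudely it is a difference of two averages of benchmark states, at most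
  \<open>2 * X\<close>; this is the origin of the term \<open>2 * \<Lambda> * X\<close> in
  \<open>D\<close>. Sharply, all candidates share the same disturbance, and a change of weights has
  total mass 0 and cancels it: what remains is \<open>[A B]\<close> applied to the change of the
  mean joint vector. Hence \<open>B_plus\<close>, and hence the variance of the very round whose
  slack is available. The choice of \<open>\<eta>\<close> amounts to \<open>16 * \<eta> * L\<^sup>2
  * (1 + \<Lambda> * B_plus A B) = \<mu>\<close>: the summand 1 serves the mixture loss, the other
  one the tracking cost. For a universal constant the cover may cost only the logarithm of
  \<open>1 + RK / \<epsilon>\<close> per entry. A grid on a cube of entries would put a further
  power of the dimensions into that logarithm; counting integer points in an \<open>l1\<close> ball
  does not.\<close>

lemma vnorm_eq_L2_set: "vnorm v = L2_set (\<lambda>i. v $ i) {..<dim_vec v}"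
  by (simp add: vnorm_def L2_set_def scalar_prod_def power2_eq_square lessThan_atLeast0)

lemma vnorm_nonneg [simp]: "0 \<le> vnorm v"
  by (simp add: vnorm_eq_L2_set)

lemma vnorm_sq: "(vnorm v)\<^sup>2 = (\<Sum>i<dim_vec v. (v $ i)\<^sup>2)"
  by (simp add: vnorm_eq_L2_set L2_set_def sum_nonneg)

lemma scalar_prod_self: "v \<bullet> v = (vnorm v)\<^sup>2"
  unfolding vnorm_sq by (simp add: scalar_prod_def power2_eq_square lessThan_atLeast0)

lemma vnorm_zero [simp]: "vnorm (0\<^sub>v n) = 0"
  by (simp add: vnorm_eq_L2_set L2_set_def)

lemma vnorm_smult: "vnorm (a \<cdot>\<^sub>v v) = \<bar>a\<bar> * vnorm v"
  by (simp add: vnorm_eq_L2_set L2_set_def power_mult_distrib real_sqrt_mult flip: sum_distrib_left)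

lemma vnorm_uminus [simp]: "vnorm (- v) = vnorm v"
  by (simp add: vnorm_eq_L2_set L2_set_def)

lemma vnorm_triangle:
  assumes "dim_vec v = dim_vec w"
  shows "vnorm (v + w) \<le> vnorm v + vnorm w"
  using L2_set_triangle_ineq[of "\<lambda>i. v $ i" "\<lambda>i. w $ i" "{..<dim_vec w}"] assms
  by (simp add: vnorm_eq_L2_set cong: L2_set_cong_simp)

lemma vnorm_minus_commute:
  assumes "dim_vec v = dim_vec w"
  shows "vnorm (v - w) = vnorm (w - v)"
  unfolding vnorm_eq_L2_set using assms
  by (auto simp: L2_set_def power2_commute intro!: sum.cong)

lemma vnorm_triangle_minus:
  assumes "dim_vec v = dim_vec w"
  shows "vnorm (v - w) \<le> vnorm v + vnorm w"
proof -
  have "v - w = v + - w" using assms by auto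
  then show ?thesis using vnorm_triangle[of v "- w"] assms by simp
qed

lemma abs_scalar_prod_le:
  assumes "dim_vec v = dim_vec w"
  shows "\<bar>v \<bullet> w\<bar> \<le> vnorm v * vnorm w"
proof -
  have "\<bar>v \<bullet> w\<bar> \<le> (\<Sum>i<dim_vec w. \<bar>v $ i\<bar> * \<bar>w $ i\<bar>)"
    unfolding scalar_prod_def lessThan_atLeast0
    by (rule order_trans[OF sum_abs]) (simp add: abs_mult)
  also have "\<dots> \<le> vnorm v * vnorm w"
    unfolding vnorm_eq_L2_set using L2_set_mult_ineq[of "\<lambda>i. v $ i" "\<lambda>i. w $ i" "{..<dim_vec w}"] assms
    by simp
  finally show ?thesis .
qed

lemma vnorm_eq_0:
  assumes "vnorm v = 0" shows "v = 0\<^sub>v (dim_vec v)"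
  using assms by (auto simp: vnorm_eq_L2_set L2_set_eq_0_iff)

lemma abs_index_le_vnorm:
  assumes "i < dim_vec v" shows "\<bar>v $ i\<bar> \<le> vnorm v"
proof -
  have "(v $ i)\<^sup>2 \<le> (\<Sum>i<dim_vec v. (v $ i)\<^sup>2)"
    using assms by (intro member_le_sum) auto
  then show ?thesis unfolding vnorm_sq[symmetric] by (metis abs_of_nonneg abs_le_square_iff vnorm_nonneg)
qed

lemma vnorm_append_sq: "(vnorm (v @\<^sub>v w))\<^sup>2 = (vnorm v)\<^sup>2 + (vnorm w)\<^sup>2"
proof -
  have split: "(\<Sum>i<m + k. f i) = (\<Sum>i<m. f i) + (\<Sum>i<k. f (m + i))" for m k and f :: "nat \<Rightarrow> real"
    by (induction k) simp_all
  show ?thesis by (simp add: vnorm_sq split)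
qed

lemma vnorm_append_le: "vnorm (v @\<^sub>v w) \<le> vnorm v + vnorm w"
  by (rule power2_le_imp_le) (auto simp: vnorm_append_sq power2_sum)

lemma vnorm_append_ge1: "vnorm v \<le> vnorm (v @\<^sub>v w)"
  by (rule power2_le_imp_le) (auto simp: vnorm_append_sq)

text \<open>A real \<open>SUP\<close> carries information only for a bounded family. Cauchy-Schwarz
  on each row provides a crude bound, the sum of the row norms.\<close>

lemma bdd_above_op_norm: "bdd_above ((\<lambda>v. vnorm (M *\<^sub>v v)) ` vball (dim_col M) 1)"
proof (rule bdd_aboveI2)
  fix v assume v: "v \<in> vball (dim_col M) 1"
  then have d: "dim_vec v = dim_col M" and n: "vnorm v \<le> 1" by (auto simp: vball_def)
  have "vnorm (M *\<^sub>v v) \<le> (\<Sum>i<dim_row M. \<bar>(M *\<^sub>v v) $ i\<bar>)"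
    unfolding vnorm_eq_L2_set by (rule order_trans[OF L2_set_le_sum_abs]) simp
  also have "\<dots> \<le> (\<Sum>i<dim_row M. vnorm (row M i))"
  proof (rule sum_mono)
    fix i assume "i \<in> {..<dim_row M}"
    then have "\<bar>(M *\<^sub>v v) $ i\<bar> \<le> vnorm (row M i) * vnorm v"
      using abs_scalar_prod_le[of "row M i" v] d by simp
    also have "\<dots> \<le> vnorm (row M i)" using n by (simp add: mult_left_le)
    finally show "\<bar>(M *\<^sub>v v) $ i\<bar> \<le> vnorm (row M i)" .
  qed
  finally show "vnorm (M *\<^sub>v v) \<le> (\<Sum>i<dim_row M. vnorm (row M i))" .
qed

lemma zero_in_vball: "0 \<le> D \<Longrightarrow> 0\<^sub>v n \<in> vball n D"
  by (simp add: vball_def)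

lemma op_norm_nonneg [simp]: "0 \<le> op_norm M"
  unfolding op_norm_def
  by (rule cSUP_upper2[OF bdd_above_op_norm zero_in_vball]) auto

lemma vnorm_mult_mat_vec_le:
  assumes "dim_vec v = dim_col M"
  shows "vnorm (M *\<^sub>v v) \<le> op_norm M * vnorm v"
proof (cases "vnorm v = 0")
  case True
  then have "v = 0\<^sub>v (dim_col M)" using vnorm_eq_0[of v] assms by simp
  moreover have "M *\<^sub>v 0\<^sub>v (dim_col M) = 0\<^sub>v (dim_row M)" by (intro eq_vecI) auto
  ultimately show ?thesis by simp
next
  case False
  then have p: "0 < vnorm v" by (simp add: order_less_le)
  let ?u = "(1 / vnorm v) \<cdot>\<^sub>v v"
  have vc: "v \<in> carrier_vec (dim_col M)" by (rule carrier_vecI[OF assms])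
  have "?u \<in> vball (dim_col M) 1" using vc p by (simp add: vball_def vnorm_smult)
  then have "vnorm (M *\<^sub>v ?u) \<le> op_norm M"
    unfolding op_norm_def by (rule cSUP_upper[OF _ bdd_above_op_norm])
  moreover have "M *\<^sub>v ?u = (1 / vnorm v) \<cdot>\<^sub>v (M *\<^sub>v v)"
    by (rule mult_mat_vec[of M "dim_row M" "dim_col M"]) (use vc in simp_all)
  ultimately show ?thesis using p by (simp add: vnorm_smult field_simps)
qed

lemma op_norm_le:
  assumes "\<And>v. v \<in> carrier_vec (dim_col M) \<Longrightarrow> vnorm (M *\<^sub>v v) \<le> b * vnorm v" "0 \<le> b"
  shows "op_norm M \<le> b"
  unfolding op_norm_def
proof (rule cSUP_least)
  show "vball (dim_col M) 1 \<noteq> {}" using zero_in_vball[of 1] by auto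
next
  fix v assume v: "v \<in> vball (dim_col M) 1"
  then have "vnorm (M *\<^sub>v v) \<le> b * vnorm v" by (intro assms) (auto simp: vball_def)
  also have "\<dots> \<le> b" using v assms(2) by (auto simp: vball_def mult_left_le)
  finally show "vnorm (M *\<^sub>v v) \<le> b" .
qed

lemma op_norm_mult:
  assumes "dim_col M = dim_row P"
  shows "op_norm (M * P) \<le> op_norm M * op_norm P"
proof (rule op_norm_le)
  fix v :: "real vec" assume v: "v \<in> carrier_vec (dim_col (M * P))"
  have "(M * P) *\<^sub>v v = M *\<^sub>v (P *\<^sub>v v)"
    by (rule assoc_mult_mat_vec[of _ "dim_row M" "dim_col M" _ "dim_col P"]) (use assms v in auto)
  then have "vnorm ((M * P) *\<^sub>v v) \<le> op_norm M * vnorm (P *\<^sub>v v)"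
    using vnorm_mult_mat_vec_le[of "P *\<^sub>v v" M] assms by simp
  also have "\<dots> \<le> op_norm M * (op_norm P * vnorm v)"
    by (rule mult_left_mono[OF vnorm_mult_mat_vec_le]) (use v in auto)
  finally show "vnorm ((M * P) *\<^sub>v v) \<le> op_norm M * op_norm P * vnorm v" by (simp add: mult.assoc)
qed simp

lemma op_norm_add:
  assumes "M \<in> carrier_mat n m" "P \<in> carrier_mat n m"
  shows "op_norm (M + P) \<le> op_norm M + op_norm P"
proof (rule op_norm_le)
  fix v :: "real vec" assume v: "v \<in> carrier_vec (dim_col (M + P))"
  have "(M + P) *\<^sub>v v = M *\<^sub>v v + P *\<^sub>v v"
    by (rule add_mult_distrib_mat_vec) (use assms v in auto)
  then have "vnorm ((M + P) *\<^sub>v v) \<le> vnorm (M *\<^sub>v v) + vnorm (P *\<^sub>v v)"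
    using vnorm_triangle[of "M *\<^sub>v v" "P *\<^sub>v v"] assms by simp
  also have "\<dots> \<le> (op_norm M + op_norm P) * vnorm v"
    using vnorm_mult_mat_vec_le[of v M] vnorm_mult_mat_vec_le[of v P] v assms
    by (simp add: algebra_simps)
  finally show "vnorm ((M + P) *\<^sub>v v) \<le> (op_norm M + op_norm P) * vnorm v" .
qed simp

lemma op_norm_le_entries:
  "op_norm M \<le> sqrt (\<Sum>i<dim_row M. \<Sum>j<dim_col M. (M $$ (i, j))\<^sup>2)"
proof (rule op_norm_le)
  fix v :: "real vec" assume v: "v \<in> carrier_vec (dim_col M)"
  have row: "((M *\<^sub>v v) $ i)\<^sup>2 \<le> (\<Sum>j<dim_col M. (M $$ (i, j))\<^sup>2) * (vnorm v)\<^sup>2" if i: "i < dim_row M" for i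
  proof -
    have "\<bar>(M *\<^sub>v v) $ i\<bar> \<le> vnorm (row M i) * vnorm v"
      using abs_scalar_prod_le[of "row M i" v] v i by simp
    then have "((M *\<^sub>v v) $ i)\<^sup>2 \<le> (vnorm (row M i) * vnorm v)\<^sup>2"
      by (metis abs_ge_zero power2_abs power_mono)
    also have "\<dots> = (vnorm (row M i))\<^sup>2 * (vnorm v)\<^sup>2" by (simp add: power_mult_distrib)
    also have "(vnorm (row M i))\<^sup>2 = (\<Sum>j<dim_col M. (M $$ (i, j))\<^sup>2)" using i by (simp add: vnorm_sq)
    finally show ?thesis .
  qed
  have "(vnorm (M *\<^sub>v v))\<^sup>2 \<le> (\<Sum>i<dim_row M. (\<Sum>j<dim_col M. (M $$ (i, j))\<^sup>2) * (vnorm v)\<^sup>2)"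
    unfolding vnorm_sq[of "M *\<^sub>v v"] dim_mult_mat_vec by (intro sum_mono row) simp
  also have "\<dots> = (sqrt (\<Sum>i<dim_row M. \<Sum>j<dim_col M. (M $$ (i, j))\<^sup>2) * vnorm v)\<^sup>2"
    by (simp add: power_mult_distrib sum_nonneg sum_distrib_right)
  finally show "vnorm (M *\<^sub>v v) \<le> sqrt (\<Sum>i<dim_row M. \<Sum>j<dim_col M. (M $$ (i, j))\<^sup>2) * vnorm v"
    by (rule power2_le_imp_le) (simp add: sum_nonneg)
qed (simp add: sum_nonneg)

lemma mat_vec_unit: "j < dim_col M \<Longrightarrow> M *\<^sub>v unit_vec (dim_col M) j = (col M j :: real vec)"
  by (intro eq_vecI) auto

text \<open>Columns are images of unit vectors, which gives the factor \<open>dim_col M\<close>.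
  Testing \<open>M\<close> on its own row \<open>i\<close> produces the squared norm of that row as
  an entry, which gives the factor \<open>dim_row M\<close>. The better of the two is the origin of
  \<open>min\<close> in \<open>RK\<close>.\<close>

lemma frobenius_le_op_norm:
  "(\<Sum>i<dim_row M. \<Sum>j<dim_col M. (M $$ (i, j))\<^sup>2)
     \<le> real (min (dim_row M) (dim_col M)) * (op_norm M)\<^sup>2"
proof -
  have "(\<Sum>i<dim_row M. (M $$ (i, j))\<^sup>2) \<le> (op_norm M)\<^sup>2" if j: "j < dim_col M" for j
  proof -
    have "vnorm (col M j) \<le> op_norm M * vnorm (unit_vec (dim_col M) j)"
      using vnorm_mult_mat_vec_le[of "unit_vec (dim_col M) j" M] j
      by (simp add: mat_vec_unit)
    also have "vnorm (unit_vec (dim_col M) j) = 1"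
      using j by (simp add: vnorm_def)
    finally have "(vnorm (col M j))\<^sup>2 \<le> (op_norm M)\<^sup>2" by (simp add: power_mono)
    then show ?thesis using j by (simp add: vnorm_sq)
  qed
  then have "(\<Sum>j<dim_col M. \<Sum>i<dim_row M. (M $$ (i, j))\<^sup>2) \<le> (\<Sum>j<dim_col M. (op_norm M)\<^sup>2)"
    by (intro sum_mono) auto
  then have c: "(\<Sum>i<dim_row M. \<Sum>j<dim_col M. (M $$ (i, j))\<^sup>2) \<le> real (dim_col M) * (op_norm M)\<^sup>2"
    by (subst sum.swap) simp
  have "(\<Sum>j<dim_col M. (M $$ (i, j))\<^sup>2) \<le> (op_norm M)\<^sup>2" if i: "i < dim_row M" for i
  proof -
    let ?r = "row M i"
    have "(vnorm ?r)\<^sup>2 = (M *\<^sub>v ?r) $ i"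
      using i by (simp add: scalar_prod_self)
    also have "\<dots> \<le> vnorm (M *\<^sub>v ?r)" using abs_index_le_vnorm[of i "M *\<^sub>v ?r"] i by simp
    also have "\<dots> \<le> op_norm M * vnorm ?r" by (rule vnorm_mult_mat_vec_le) simp
    finally have "vnorm ?r * vnorm ?r \<le> op_norm M * vnorm ?r" by (simp add: power2_eq_square)
    then have "vnorm ?r \<le> op_norm M"
      by (cases "vnorm ?r = 0") (auto simp: order_less_le)
    then have "(vnorm ?r)\<^sup>2 \<le> (op_norm M)\<^sup>2" by (simp add: power_mono)
    then show ?thesis using i by (simp add: vnorm_sq)
  qed
  then have "(\<Sum>i<dim_row M. \<Sum>j<dim_col M. (M $$ (i, j))\<^sup>2) \<le> (\<Sum>i<dim_row M. (op_norm M)\<^sup>2)"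
    by (intro sum_mono) auto
  then have "(\<Sum>i<dim_row M. \<Sum>j<dim_col M. (M $$ (i, j))\<^sup>2) \<le> real (dim_row M) * (op_norm M)\<^sup>2"
    by simp
  with c show ?thesis by (simp add: min_def)
qed

subsection \<open>Linear dynamics\<close>

lemma mult_mat_vec_zero [simp]: "(M :: real mat) *\<^sub>v 0\<^sub>v (dim_col M) = 0\<^sub>v (dim_row M)"
  by (intro eq_vecI) auto

lemma mult_pow_mat_comm:
  fixes F :: "real mat"
  assumes "F \<in> carrier_mat n n"
  shows "F * F ^\<^sub>m k = F ^\<^sub>m Suc k"
proof (induction k)
  case 0
  then show ?case using assms by simp
next
  case (Suc k)
  have "F * F ^\<^sub>m Suc k = (F * F ^\<^sub>m k) * F"
    using assms assoc_mult_mat[of F n n "F ^\<^sub>m k" n F n] by simp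
  also have "\<dots> = F ^\<^sub>m Suc (Suc k)" by (simp add: Suc)
  finally show ?case .
qed

lemma linear_recurrence_carrier:
  fixes z v :: "nat \<Rightarrow> real vec"
  assumes F: "F \<in> carrier_mat n n" and t: "1 \<le> t" and z1: "z 1 = 0\<^sub>v n"
    and v: "\<And>s. s \<in> {1..<t} \<Longrightarrow> v s \<in> carrier_vec n"
    and step: "\<And>s. s \<in> {1..<t} \<Longrightarrow> z (Suc s) = F *\<^sub>v z s + v s"
  shows "z t \<in> carrier_vec n"
  using t v step
proof (induction t rule: dec_induct)
  case base
  then show ?case by (simp add: z1[simplified])
next
  case (step k)
  then show ?case using F by (simp add: add_carrier_vec)
qed

text \<open>Unrolled solution: an input at time \<open>s\<close> reaches time \<open>t\<close>
  through \<open>t - 1 - s\<close> powers of \<open>F\<close>. The output matrix \<open>M\<close> is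
  generalized in the induction, because the step absorbs one factor \<open>F\<close> into it.
  Keeping \<open>M\<close> inside the norms, instead of splitting off \<open>op_norm M\<close>,
  makes the terms of \<open>Lambda\<close> appear literally.\<close>

lemma linear_recurrence_bound:
  fixes z v :: "nat \<Rightarrow> real vec"
  assumes F: "F \<in> carrier_mat n n" and t: "1 \<le> t" and z1: "z 1 = 0\<^sub>v n"
    and M: "M \<in> carrier_mat m n"
    and v: "\<And>s. s \<in> {1..<t} \<Longrightarrow> v s \<in> carrier_vec n"
    and step: "\<And>s. s \<in> {1..<t} \<Longrightarrow> z (Suc s) = F *\<^sub>v z s + v s"
  shows "vnorm (M *\<^sub>v z t) \<le> (\<Sum>s\<in>{1..<t}. op_norm (M * F ^\<^sub>m (t - 1 - s)) * vnorm (v s))"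
  using t M v step
proof (induction t arbitrary: M rule: dec_induct)
  case base
  have "M *\<^sub>v 0\<^sub>v n = 0\<^sub>v m" using base mult_mat_vec_zero[of M] by simp
  then show ?case by (simp add: z1[simplified])
next
  case (step k)
  have zk: "z k \<in> carrier_vec n"
    by (rule linear_recurrence_carrier[where z = z, OF F step.hyps(1) z1]) (use step in auto)
  have vk: "v k \<in> carrier_vec n" using step by simp
  have MF: "M * F \<in> carrier_mat m n" using step.prems(1) F by auto
  have "M *\<^sub>v z (Suc k) = M *\<^sub>v (F *\<^sub>v z k) + M *\<^sub>v v k"
    using step.prems zk vk F step.hyps mult_add_distrib_mat_vec[of M m n "F *\<^sub>v z k" "v k"] by simp
  also have "M *\<^sub>v (F *\<^sub>v z k) = (M * F) *\<^sub>v z k"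
    using step.prems(1) zk F by (simp add: assoc_mult_mat_vec[of M m n F n])
  finally have "vnorm (M *\<^sub>v z (Suc k)) \<le> vnorm ((M * F) *\<^sub>v z k) + vnorm (M *\<^sub>v v k)"
    using vnorm_triangle[of "(M * F) *\<^sub>v z k" "M *\<^sub>v v k"] by simp
  also have "\<dots> \<le> (\<Sum>s\<in>{1..<k}. op_norm (M * F * F ^\<^sub>m (k - 1 - s)) * vnorm (v s)) + op_norm M * vnorm (v k)"
    by (intro add_mono step.IH[OF MF] vnorm_mult_mat_vec_le)
      (use step.prems carrier_vecD[OF vk] in auto)
  also have "(\<Sum>s\<in>{1..<k}. op_norm (M * F * F ^\<^sub>m (k - 1 - s)) * vnorm (v s))
      = (\<Sum>s\<in>{1..<k}. op_norm (M * F ^\<^sub>m (Suc k - 1 - s)) * vnorm (v s))"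
  proof (rule sum.cong[OF refl])
    fix s assume s: "s \<in> {1..<k}"
    have "M * F * F ^\<^sub>m (k - 1 - s) = M * (F * F ^\<^sub>m (k - 1 - s))"
      by (rule assoc_mult_mat) (use step.prems(1) F in auto)
    also have "F * F ^\<^sub>m (k - 1 - s) = F ^\<^sub>m (Suc k - 1 - s)"
    proof -
      have "Suc k - 1 - s = Suc (k - 1 - s)" using s by auto
      then show ?thesis using mult_pow_mat_comm[OF F, of "k - 1 - s"] by (simp only:)
    qed
    finally show "op_norm (M * F * F ^\<^sub>m (k - 1 - s)) * vnorm (v s)
        = op_norm (M * F ^\<^sub>m (Suc k - 1 - s)) * vnorm (v s)" by simp
  qed
  also have "op_norm M = op_norm (M * F ^\<^sub>m (Suc k - 1 - k))"
    using step.prems(1) F by simp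
  finally show ?case using step.hyps by (simp add: sum.atLeastLessThan_Suc)
qed

lemma sum_convolution_index:
  fixes f :: "nat \<Rightarrow> real"
  shows "(\<Sum>s\<in>{1..<t}. f (t - 1 - s)) = (\<Sum>r<t - 1. f r)"
  by (rule sum.reindex_bij_witness[of _ "\<lambda>r. t - 1 - r" "\<lambda>s. t - 1 - s"]) auto

lemma sum_geometric_le:
  fixes \<gamma> :: real
  assumes "0 < \<gamma>" "\<gamma> < 1"
  shows "(\<Sum>r<n. (1 - \<gamma>) ^ r) \<le> 1 / \<gamma>"
proof -
  have "\<gamma> * (\<Sum>r<n. (1 - \<gamma>) ^ r) = 1 - (1 - \<gamma>) ^ n"
    using one_diff_power_eq[of "1 - \<gamma>" n] by simp
  also have "\<dots> \<le> 1" using assms by simp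
  finally show ?thesis using assms by (simp add: field_simps)
qed

lemma linear_recurrence_geometric:
  fixes z v :: "nat \<Rightarrow> real vec"
  assumes F: "F \<in> carrier_mat n n" and t: "1 \<le> t" and z1: "z 1 = 0\<^sub>v n"
    and v: "\<And>s. s \<in> {1..<t} \<Longrightarrow> v s \<in> vball n b"
    and step: "\<And>s. s \<in> {1..<t} \<Longrightarrow> z (Suc s) = F *\<^sub>v z s + v s"
    and pow: "\<And>r. op_norm (F ^\<^sub>m r) \<le> a * (1 - \<gamma>) ^ r"
    and \<gamma>: "0 < \<gamma>" "\<gamma> < 1" and "0 \<le> a" "0 \<le> b"
  shows "z t \<in> vball n (a * b / \<gamma>)"
proof -
  have zc: "z t \<in> carrier_vec n"
    by (rule linear_recurrence_carrier[OF F t z1 _ step]) (use v in \<open>auto simp: vball_def\<close>)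
  have "vnorm (1\<^sub>m n *\<^sub>v z t) \<le> (\<Sum>s\<in>{1..<t}. op_norm (1\<^sub>m n * F ^\<^sub>m (t - 1 - s)) * vnorm (v s))"
    by (rule linear_recurrence_bound[OF F t z1 _ _ step]) (use v in \<open>auto simp: vball_def\<close>)
  also have "\<dots> \<le> (\<Sum>s\<in>{1..<t}. a * (1 - \<gamma>) ^ (t - 1 - s) * b)"
    using v pow \<gamma> assms by (intro sum_mono mult_mono) (auto simp: vball_def)
  also have "\<dots> = a * b * (\<Sum>s\<in>{1..<t}. (1 - \<gamma>) ^ (t - 1 - s))"
    by (simp add: sum_distrib_left mult_ac)
  also have "(\<Sum>s\<in>{1..<t}. (1 - \<gamma>) ^ (t - 1 - s)) = (\<Sum>r<t - 1. (1 - \<gamma>) ^ r)"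
    by (rule sum_convolution_index)
  also have "a * b * (\<Sum>r<t - 1. (1 - \<gamma>) ^ r) \<le> a * b * (1 / \<gamma>)"
    using \<gamma> \<open>0 \<le> a\<close> \<open>0 \<le> b\<close> by (intro mult_left_mono sum_geometric_le) auto
  finally show ?thesis using zc by (simp add: vball_def)
qed

lemma rollout_Suc:
  "1 \<le> t \<Longrightarrow> rollout A B \<pi> w (Suc t) = A *\<^sub>v rollout A B \<pi> w t + B *\<^sub>v \<pi> t (rollout A B \<pi> w t) + w t"
  by (cases t) auto

lemma rollout_carrier:
  assumes "A \<in> carrier_mat dx dx" "B \<in> carrier_mat dx du" "1 \<le> t"
    and "\<And>s. s \<in> {1..<t} \<Longrightarrow> w s \<in> carrier_vec dx"
  shows "rollout A B \<pi> w t \<in> carrier_vec dx"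
  using assms(3,4)
proof (induction t rule: dec_induct)
  case base
  then show ?case using assms by simp
next
  case (step k)
  then show ?case using assms(1,2) unfolding rollout_Suc[OF step.hyps(1)]
    by (intro add_carrier_vec) (auto intro!: carrier_vecI)
qed

lemma closed_loop_mult:
  fixes A B K :: "real mat"
  assumes "A \<in> carrier_mat n n" "B \<in> carrier_mat n m" "K \<in> carrier_mat m n" "x \<in> carrier_vec n"
  shows "(A - B * K) *\<^sub>v x = A *\<^sub>v x - B *\<^sub>v (K *\<^sub>v x)"
  using assms minus_mult_distrib_mat_vec[of A n n "B * K" x]
  by (simp add: assoc_mult_mat_vec[of B n m K n])

lemma linear_rollout_Suc:
  assumes A: "A \<in> carrier_mat dx dx" and B: "B \<in> carrier_mat dx du" and K: "K \<in> carrier_mat du dx"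
    and t: "1 \<le> t" and w: "\<And>s. s \<in> {1..<t} \<Longrightarrow> w s \<in> carrier_vec dx"
  shows "rollout A B (linear_law K) w (Suc t) = (A - B * K) *\<^sub>v rollout A B (linear_law K) w t + w t"
proof -
  let ?x = "rollout A B (linear_law K) w t"
  have x: "?x \<in> carrier_vec dx" by (rule rollout_carrier[OF A B t w])
  have "(A - B * K) *\<^sub>v ?x = A *\<^sub>v ?x - B *\<^sub>v (K *\<^sub>v ?x)"
    by (rule closed_loop_mult[OF A B K x])
  also have "\<dots> = A *\<^sub>v ?x + B *\<^sub>v (- (K *\<^sub>v ?x))"
  proof -
    have "B *\<^sub>v (- (K *\<^sub>v ?x)) = - (B *\<^sub>v (K *\<^sub>v ?x))"
      using A B K x by (intro eq_vecI) auto
    then show ?thesis using A B by (intro eq_vecI) auto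
  qed
  finally show ?thesis using t by (simp add: rollout_Suc linear_law_def)
qed

lemma linear_joint_eq:
  "joint A B (linear_law K) w t
     = rollout A B (linear_law K) w t @\<^sub>v - (K *\<^sub>v rollout A B (linear_law K) w t)"
  by (simp add: joint_def linear_law_def)

lemma linear_joint_carrier:
  assumes "A \<in> carrier_mat dx dx" "B \<in> carrier_mat dx du" "K \<in> carrier_mat du dx" "1 \<le> t"
    and "\<And>s. s \<in> {1..<t} \<Longrightarrow> w s \<in> carrier_vec dx"
  shows "joint A B (linear_law K) w t \<in> carrier_vec (dx + du)"
  unfolding linear_joint_eq using rollout_carrier[OF assms(1,2,4,5)] assms
  by (intro append_carrier_vec) auto

lemma policy_classD:
  assumes "K \<in> policy_class A B \<kappa> \<gamma>" "A \<in> carrier_mat dx dx" "B \<in> carrier_mat dx du"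
  shows "K \<in> carrier_mat du dx" "op_norm K \<le> \<kappa>"
    "op_norm ((A - B * K) ^\<^sub>m r) \<le> \<kappa>\<^sup>2 * (1 - \<gamma>) ^ r" "A - B * K \<in> carrier_mat dx dx"
  using assms by (auto simp: policy_class_def)

lemma append_vec_minus:
  fixes a b c d :: "real vec"
  assumes "dim_vec a = dim_vec c" "dim_vec b = dim_vec d"
  shows "(a @\<^sub>v b) - (c @\<^sub>v d) = (a - c) @\<^sub>v (b - d)"
  using assms by (intro eq_vecI) auto

section \<open>Benchmark trajectories: their size and their dependence on the gain\<close>

locale benchmark =
  fixes dx du :: nat and A B :: "real mat" and \<kappa> \<gamma> W :: real
  assumes A: "A \<in> carrier_mat dx dx" and B: "B \<in> carrier_mat dx du"
    and \<kappa>: "1 \<le> \<kappa>" and \<gamma>: "0 < \<gamma>" "\<gamma> < 1" and W: "0 < W"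
begin

abbreviation "\<K> \<equiv> policy_class A B \<kappa> \<gamma>"
definition "X = \<kappa>\<^sup>2 * W / \<gamma>"

lemma X_pos: "0 < X" using \<kappa> \<gamma> W by (simp add: X_def)

lemma state_bound:
  assumes K: "K \<in> \<K>" and t: "1 \<le> t" and w: "\<And>s. s \<in> {1..<t} \<Longrightarrow> w s \<in> vball dx W"
  shows "rollout A B (linear_law K) w t \<in> vball dx X"
  unfolding X_def
proof (rule linear_recurrence_geometric[where F = "A - B * K" and v = w])
  fix s assume s: "s \<in> {1..<t}"
  then show "rollout A B (linear_law K) w (Suc s) = (A - B * K) *\<^sub>v rollout A B (linear_law K) w s + w s"
    by (intro linear_rollout_Suc[OF A B policy_classD(1)[OF K A B]]) (use w in \<open>auto simp: vball_def\<close>)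
qed (use A policy_classD[OF K A B] t w \<gamma> W in auto)

lemma joint_bound:
  assumes K: "K \<in> \<K>" and t: "1 \<le> t" and w: "\<And>s. s \<in> {1..<t} \<Longrightarrow> w s \<in> vball dx W"
  shows "joint A B (linear_law K) w t \<in> vball (dx + du) (sqrt (1 + \<kappa>\<^sup>2) * X)"
proof -
  let ?x = "rollout A B (linear_law K) w t"
  have x: "?x \<in> vball dx X" by (rule state_bound[OF K t w])
  note Kc = policy_classD[OF K A B]
  have "vnorm (- (K *\<^sub>v ?x)) \<le> op_norm K * vnorm ?x"
    using vnorm_mult_mat_vec_le[of ?x K] x Kc by (simp add: vball_def)
  also have "\<dots> \<le> \<kappa> * X"
    using x Kc X_pos \<kappa> by (intro mult_mono) (auto simp: vball_def)
  finally have u: "vnorm (- (K *\<^sub>v ?x)) \<le> \<kappa> * X" .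
  have "(vnorm (joint A B (linear_law K) w t))\<^sup>2 \<le> X\<^sup>2 + (\<kappa> * X)\<^sup>2"
    unfolding linear_joint_eq vnorm_append_sq
    using x u by (intro add_mono power_mono) (auto simp: vball_def)
  also have "\<dots> = (sqrt (1 + \<kappa>\<^sup>2) * X)\<^sup>2"
    by (simp add: power_mult_distrib distrib_right)
  finally have "vnorm (joint A B (linear_law K) w t) \<le> sqrt (1 + \<kappa>\<^sup>2) * X"
    by (rule power2_le_imp_le) (use X_pos in auto)
  moreover have "joint A B (linear_law K) w t \<in> carrier_vec (dx + du)"
    by (rule linear_joint_carrier[OF A B Kc(1) t]) (use w in \<open>auto simp: vball_def\<close>)
  ultimately show ?thesis by (simp add: vball_def)
qed

definition "LK = \<kappa>\<^sup>2 * W / \<gamma> + (1 + \<kappa>) * \<kappa> ^ 4 * op_norm B * W / \<gamma>\<^sup>2"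

lemma LK_pos: "0 < LK"
  unfolding LK_def using \<kappa> \<gamma> W by (intro add_pos_nonneg) auto

text \<open>The difference of the two state sequences obeys the closed loop of \<open>K\<close>,
  driven by \<open>- B (K - K') x'\<close>, so powers of different closed loops are never compared.
  One factor \<open>\<kappa>\<^sup>2 / \<gamma>\<close> comes from the size of \<open>x'\<close> and
  a second one from this recurrence; the direct effect of \<open>K - K'\<close> on the action gives
  the first summand of \<open>LK\<close>.\<close>

lemma joint_lipschitz:
  assumes K: "K \<in> \<K>" and K': "K' \<in> \<K>" and t: "1 \<le> t" and w: "\<And>s. s \<in> {1..<t} \<Longrightarrow> w s \<in> vball dx W"
  shows "vnorm (joint A B (linear_law K) w t - joint A B (linear_law K') w t) \<le> LK * op_norm (K - K')"
proof -
  let ?x = "rollout A B (linear_law K) w" and ?x' = "rollout A B (linear_law K') w"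
  let ?z = "\<lambda>s. ?x s - ?x' s" and ?v = "\<lambda>s. - (B *\<^sub>v ((K - K') *\<^sub>v ?x' s))"
  let ?d = "op_norm (K - K')"
  note Kc = policy_classD[OF K A B] and Kc' = policy_classD[OF K' A B]
  have x: "?x s \<in> vball dx X" "?x' s \<in> vball dx X" if "s \<in> {1..t}" for s
    using that w by (auto intro!: state_bound K K')
  have xc: "?x s \<in> carrier_vec dx" "?x' s \<in> carrier_vec dx" if "s \<in> {1..t}" for s
    using x[OF that] by (auto simp: vball_def)
  have dv: "vnorm ((K - K') *\<^sub>v ?x' s) \<le> ?d * X" if s: "s \<in> {1..t}" for s
  proof -
    have "vnorm ((K - K') *\<^sub>v ?x' s) \<le> ?d * vnorm (?x' s)"
      by (rule vnorm_mult_mat_vec_le) (use Kc Kc' xc[OF s] in auto)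
    also have "\<dots> \<le> ?d * X" using x[OF s] by (intro mult_left_mono) (auto simp: vball_def)
    finally show ?thesis .
  qed
  have "?z t \<in> vball dx (\<kappa>\<^sup>2 * (op_norm B * (?d * X)) / \<gamma>)"
  proof (rule linear_recurrence_geometric[where F = "A - B * K" and v = ?v])
    show "?z 1 = 0\<^sub>v dx" using A by auto
  next
    fix s assume s: "s \<in> {1..<t}"
    then have s': "s \<in> {1..t}" by auto
    have "vnorm (?v s) \<le> op_norm B * vnorm ((K - K') *\<^sub>v ?x' s)"
      using vnorm_mult_mat_vec_le[of "(K - K') *\<^sub>v ?x' s" B] B Kc Kc' by simp
    also have "\<dots> \<le> op_norm B * (?d * X)" by (intro mult_left_mono dv s') simp
    finally show "?v s \<in> vball dx (op_norm B * (?d * X))"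
      using B Kc Kc' xc[OF s'] by (auto simp: vball_def intro!: carrier_vecI)
    have e: "B *\<^sub>v ((K - K') *\<^sub>v ?x' s) = B *\<^sub>v (K *\<^sub>v ?x' s) - B *\<^sub>v (K' *\<^sub>v ?x' s)"
      using B Kc Kc' xc[OF s'] minus_mult_distrib_mat_vec[of K du dx K' "?x' s"]
        mult_minus_distrib_mat_vec[of B dx du "K *\<^sub>v ?x' s" "K' *\<^sub>v ?x' s"] by auto
    note c = closed_loop_mult[OF A B]
    have r: "?x (Suc s) = (A - B * K) *\<^sub>v ?x s + w s" "?x' (Suc s) = (A - B * K') *\<^sub>v ?x' s + w s"
      by (rule linear_rollout_Suc[OF A B Kc(1)] linear_rollout_Suc[OF A B Kc'(1)];
        use s w in \<open>auto simp: vball_def\<close>)+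
    have ws: "w s \<in> carrier_vec dx" using w[OF s] by (simp add: vball_def)
    have Kz: "(A - B * K) *\<^sub>v (?x s - ?x' s) = (A - B * K) *\<^sub>v ?x s - (A - B * K) *\<^sub>v ?x' s"
      by (rule mult_minus_distrib_mat_vec[OF Kc(4)]) (use xc[OF s'] in auto)
    \<comment> \<open>Here \<open>b'\<close> stands for \<open>B K x'\<close>. Adding and
      subtracting it turns the loop of \<open>K'\<close> into that of \<open>K\<close>, and the
      common disturbance cancels.\<close>
    have alg: "(a - b + w') - (a' - b'' + w') = (a - b - (a' - b')) + - (b' - b'')"
      if "dim_vec a = dx" "dim_vec b = dx" "dim_vec a' = dx" "dim_vec b' = dx" "dim_vec b'' = dx" "dim_vec w' = dx"
      for a b a' b' b'' w' :: "real vec"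
      using that by (intro eq_vecI) auto
    show "?z (Suc s) = (A - B * K) *\<^sub>v ?z s + ?v s"
      unfolding r e Kz c[OF Kc(1) xc(1)[OF s']] c[OF Kc(1) xc(2)[OF s']] c[OF Kc'(1) xc(2)[OF s']]
      by (rule alg) (use carrier_vecD[OF ws] A B in simp_all)
  qed (use A B Kc t \<gamma> X_pos in auto)
  then have z: "vnorm (?z t) \<le> \<kappa>\<^sup>2 * (op_norm B * (?d * X)) / \<gamma>" by (simp add: vball_def)
  have tt: "t \<in> {1..t}" using t by simp
  have "joint A B (linear_law K) w t - joint A B (linear_law K') w t
      = ?z t @\<^sub>v (- (K *\<^sub>v ?z t + (K - K') *\<^sub>v ?x' t))"
  proof -
    have "K *\<^sub>v ?z t = K *\<^sub>v ?x t - K *\<^sub>v ?x' t"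
      by (rule mult_minus_distrib_mat_vec[OF Kc(1) xc[OF tt]])
    moreover have "(K - K') *\<^sub>v ?x' t = K *\<^sub>v ?x' t - K' *\<^sub>v ?x' t"
      by (rule minus_mult_distrib_mat_vec[OF Kc(1) Kc'(1) xc(2)[OF tt]])
    moreover have "- a - - c = - ((a - b) + (b - c))"
      if "dim_vec a = du" "dim_vec b = du" "dim_vec c = du" for a b c :: "real vec"
      using that by (intro eq_vecI) auto
    ultimately have "- (K *\<^sub>v ?x t) - - (K' *\<^sub>v ?x' t) = - (K *\<^sub>v ?z t + (K - K') *\<^sub>v ?x' t)"
      using Kc(1) Kc'(1) by simp
    then show ?thesis
      unfolding linear_joint_eq
      by (subst append_vec_minus) (use Kc(1) Kc'(1) carrier_vecD[OF xc(1)[OF tt]] carrier_vecD[OF xc(2)[OF tt]] in simp_all)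
  qed
  then have "vnorm (joint A B (linear_law K) w t - joint A B (linear_law K') w t)
      \<le> vnorm (?z t) + vnorm (K *\<^sub>v ?z t + (K - K') *\<^sub>v ?x' t)"
    using vnorm_append_le[of "?z t" "- (K *\<^sub>v ?z t + (K - K') *\<^sub>v ?x' t)"] by simp
  also have "vnorm (K *\<^sub>v ?z t + (K - K') *\<^sub>v ?x' t) \<le> vnorm (K *\<^sub>v ?z t) + vnorm ((K - K') *\<^sub>v ?x' t)"
    using Kc Kc' by (intro vnorm_triangle) auto
  also have "vnorm (K *\<^sub>v ?z t) \<le> \<kappa> * vnorm (?z t)"
    by (rule order_trans[OF vnorm_mult_mat_vec_le mult_right_mono]) (use Kc xc[OF tt] in auto)
  also have "vnorm ((K - K') *\<^sub>v ?x' t) \<le> ?d * X" by (rule dv[OF tt])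
  finally have "vnorm (joint A B (linear_law K) w t - joint A B (linear_law K') w t)
      \<le> (1 + \<kappa>) * vnorm (?z t) + ?d * X" by (simp add: algebra_simps)
  also have "\<dots> \<le> (1 + \<kappa>) * (\<kappa>\<^sup>2 * (op_norm B * (?d * X)) / \<gamma>) + ?d * X"
    using z \<kappa> by (intro add_right_mono mult_left_mono) auto
  also have "\<dots> = LK * ?d"
  proof -
    have "\<kappa> ^ 4 = \<kappa>\<^sup>2 * \<kappa>\<^sup>2" by (simp flip: power_add)
    then show ?thesis by (simp add: LK_def X_def power2_eq_square[of \<gamma>] algebra_simps)
  qed
  finally show ?thesis .
qed

end

text \<open>The reference \<open>xb\<close>, \<open>ub\<close> may violate the dynamics. With
  \<open>e = x - xb\<close> the feedback gives \<open>e' = (A - B K0) e + v\<close>, where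
  \<open>v\<close> is the violation, and the joint error is \<open>e\<close> multiplied by the block
  column of the identity and \<open>- K0\<close>. Taking this block as the output matrix of
  \<open>linear_recurrence_bound\<close> gives the summands of \<open>Lambda\<close>.\<close>

lemma tracking_error_bound:
  fixes A B K0 :: "real mat"
  assumes A: "A \<in> carrier_mat dx dx" and B: "B \<in> carrier_mat dx du" and K0: "K0 \<in> carrier_mat du dx"
    and \<pi>: "\<And>s x. s \<in> {1..t} \<Longrightarrow> \<pi> s x = ub s - K0 *\<^sub>v (x - xb s)"
    and xb: "\<And>s. s \<in> {1..t} \<Longrightarrow> xb s \<in> carrier_vec dx" and ub: "\<And>s. s \<in> {1..t} \<Longrightarrow> ub s \<in> carrier_vec du"
    and w: "\<And>s. s \<in> {1..<t} \<Longrightarrow> w s \<in> carrier_vec dx"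
    and xb1: "xb 1 = 0\<^sub>v dx" and t: "1 \<le> t"
  shows "joint A B \<pi> w t \<in> carrier_vec (dx + du)"
    and "vnorm (joint A B \<pi> w t - (xb t @\<^sub>v ub t))
      \<le> (\<Sum>s\<in>{1..<t}. op_norm ((1\<^sub>m dx @\<^sub>r (- K0)) * (A - B * K0) ^\<^sub>m (t - 1 - s))
            * vnorm (A *\<^sub>v xb s + B *\<^sub>v ub s + w s - xb (Suc s)))"
proof -
  let ?x = "rollout A B \<pi> w"
  let ?e = "\<lambda>s. ?x s - xb s"
  let ?v = "\<lambda>s. A *\<^sub>v xb s + B *\<^sub>v ub s + w s - xb (Suc s)"
  let ?\<Phi> = "1\<^sub>m dx @\<^sub>r (- K0)"
  have x: "?x s \<in> carrier_vec dx" if "s \<in> {1..t}" for s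
    by (rule rollout_carrier[OF A B]) (use that w in auto)
  have tt: "t \<in> {1..t}" using t by simp
  have \<Phi>: "?\<Phi> \<in> carrier_mat (dx + du) dx" using K0 by auto
  have ev: "?\<Phi> *\<^sub>v ?e t = joint A B \<pi> w t - (xb t @\<^sub>v ub t)"
  proof -
    have ec: "?e t \<in> carrier_vec dx" using x[OF tt] xb[OF tt] by simp
    have "?\<Phi> *\<^sub>v ?e t = ?e t @\<^sub>v (- (K0 *\<^sub>v ?e t))"
      using mat_mult_append[OF one_carrier_mat[of dx] _ ec, of "- K0" du] K0 ec
        uminus_mult_mat_vec[of "?e t" K0] carrier_vecD[OF ec] by simp
    moreover have "u - k - u = - k" if "dim_vec u = du" "dim_vec k = du" for u k :: "real vec"
      using that by (intro eq_vecI) auto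
    then have "\<pi> t (?x t) - ub t = - (K0 *\<^sub>v ?e t)"
      using \<pi>[OF tt] K0 carrier_vecD[OF ub[OF tt]] by simp
    moreover have "joint A B \<pi> w t - (xb t @\<^sub>v ub t) = ?e t @\<^sub>v (\<pi> t (?x t) - ub t)"
      unfolding joint_def
      by (rule append_vec_minus)
        (use carrier_vecD[OF x[OF tt]] carrier_vecD[OF xb[OF tt]] carrier_vecD[OF ub[OF tt]] \<pi>[OF tt] K0 in simp_all)
    ultimately show ?thesis by simp
  qed
  show "joint A B \<pi> w t \<in> carrier_vec (dx + du)"
    unfolding joint_def using x[OF tt] \<pi>[OF tt] ub[OF tt] K0
    by (intro append_carrier_vec) (auto intro!: carrier_vecI)
  have "vnorm (?\<Phi> *\<^sub>v ?e t) \<le> (\<Sum>s\<in>{1..<t}. op_norm (?\<Phi> * (A - B * K0) ^\<^sub>m (t - 1 - s)) * vnorm (?v s))"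
  proof (rule linear_recurrence_bound[where n = dx and m = "dx + du"])
    show "?e 1 = 0\<^sub>v dx" using A xb1 by auto
  next
    fix s assume "s \<in> {1..<t}"
    then have s: "s \<in> {1..t}" "Suc s \<in> {1..t}" "1 \<le> s" and ws: "w s \<in> carrier_vec dx" using w by auto
    have ec: "?e s \<in> carrier_vec dx" using x[OF s(1)] xb[OF s(1)] by simp
    show "?v s \<in> carrier_vec dx"
      using A B ws xb[OF s(2)] by (intro minus_carrier_vec add_carrier_vec carrier_vecI) auto
    have alg: "a + (b - k) + w' - y = (a - a' - k) + (a' + b + w' - y)"
      if "dim_vec a = dx" "dim_vec a' = dx" "dim_vec b = dx" "dim_vec k = dx" "dim_vec w' = dx" "dim_vec y = dx"
      for a a' b k w' y :: "real vec"
      using that by (intro eq_vecI) auto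
    have Bd: "B *\<^sub>v (ub s - K0 *\<^sub>v ?e s) = B *\<^sub>v ub s - B *\<^sub>v (K0 *\<^sub>v ?e s)"
      using mult_minus_distrib_mat_vec[OF B ub[OF s(1)], of "K0 *\<^sub>v ?e s"] K0 ec by simp
    have Ad: "A *\<^sub>v ?e s = A *\<^sub>v ?x s - A *\<^sub>v xb s"
      by (rule mult_minus_distrib_mat_vec[OF A x[OF s(1)] xb[OF s(1)]])
    show "?e (Suc s) = (A - B * K0) *\<^sub>v ?e s + ?v s"
      unfolding rollout_Suc[OF s(3)] \<pi>[OF s(1)] Bd closed_loop_mult[OF A B K0 ec] Ad
      by (rule alg) (use A B carrier_vecD[OF ws] carrier_vecD[OF xb[OF s(2)]] in simp_all)
  qed (use A B K0 t in auto)
  then show "vnorm (joint A B \<pi> w t - (xb t @\<^sub>v ub t))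
      \<le> (\<Sum>s\<in>{1..<t}. op_norm (?\<Phi> * (A - B * K0) ^\<^sub>m (t - 1 - s)) * vnorm (?v s))"
    unfolding ev .
qed

lemma B_plus_bound:
  assumes A: "A \<in> carrier_mat n k" and B: "B \<in> carrier_mat n m"
    and x: "x \<in> carrier_vec k" and u: "u \<in> carrier_vec m"
  shows "vnorm (A *\<^sub>v x + B *\<^sub>v u) \<le> B_plus A B * vnorm (x @\<^sub>v u)"
proof -
  let ?M = "four_block_mat A B (0\<^sub>m 0 k) (0\<^sub>m 0 m) :: real mat"
  have "?M *\<^sub>v (x @\<^sub>v u) = (A *\<^sub>v x + B *\<^sub>v u) @\<^sub>v (0\<^sub>m 0 k *\<^sub>v x + 0\<^sub>m 0 m *\<^sub>v u)"
    by (rule four_block_mat_mult_vec[OF A B _ _ x u]) auto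
  then have "vnorm (A *\<^sub>v x + B *\<^sub>v u) \<le> vnorm (?M *\<^sub>v (x @\<^sub>v u))"
    by (simp add: vnorm_append_ge1)
  also have "\<dots> \<le> op_norm ?M * vnorm (x @\<^sub>v u)"
    by (rule vnorm_mult_mat_vec_le) (use A x u in auto)
  finally show ?thesis using A B by (simp add: B_plus_def)
qed

lemma B_plus_le:
  assumes A: "A \<in> carrier_mat n k" and B: "B \<in> carrier_mat n m"
  shows "B_plus A B \<le> op_norm A + op_norm B"
  unfolding B_plus_def carrier_matD[OF A] carrier_matD[OF B]
proof (rule op_norm_le)
  let ?M = "four_block_mat A B (0\<^sub>m 0 k) (0\<^sub>m 0 m) :: real mat"
  fix v :: "real vec" assume v: "v \<in> carrier_vec (dim_col ?M)"
  define x u where "x = vec_first v k" and "u = vec_last v m"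
  have x: "x \<in> carrier_vec k" and u: "u \<in> carrier_vec m" by (simp_all add: x_def u_def)
  have vv: "v = x @\<^sub>v u" using v A B by (simp add: x_def u_def)
  have xv: "vnorm x \<le> vnorm v" unfolding vv by (rule vnorm_append_ge1)
  have uv: "vnorm u \<le> vnorm v" unfolding vv
    by (rule power2_le_imp_le) (auto simp: vnorm_append_sq)
  have "?M *\<^sub>v (x @\<^sub>v u) = (A *\<^sub>v x + B *\<^sub>v u) @\<^sub>v (0\<^sub>m 0 k *\<^sub>v x + 0\<^sub>m 0 m *\<^sub>v u)"
    by (rule four_block_mat_mult_vec[OF A B _ _ x u]) auto
  then have "vnorm (?M *\<^sub>v v) \<le> vnorm (A *\<^sub>v x + B *\<^sub>v u) + vnorm (0\<^sub>m 0 k *\<^sub>v x + 0\<^sub>m 0 m *\<^sub>v u :: real vec)"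
    unfolding vv by (simp add: vnorm_append_le)
  also have "vnorm (0\<^sub>m 0 k *\<^sub>v x + 0\<^sub>m 0 m *\<^sub>v u :: real vec) = 0" by (simp add: vnorm_eq_L2_set)
  also have "vnorm (A *\<^sub>v x + B *\<^sub>v u) \<le> vnorm (A *\<^sub>v x) + vnorm (B *\<^sub>v u)"
    using A B by (intro vnorm_triangle) auto
  also have "vnorm (A *\<^sub>v x) \<le> op_norm A * vnorm v"
    by (rule order_trans[OF vnorm_mult_mat_vec_le mult_left_mono[OF xv]]) (use A x in auto)
  also have "vnorm (B *\<^sub>v u) \<le> op_norm B * vnorm v"
    by (rule order_trans[OF vnorm_mult_mat_vec_le mult_left_mono[OF uv]]) (use B u in auto)
  finally show "vnorm (?M *\<^sub>v v) \<le> (op_norm A + op_norm B) * vnorm v" by (simp add: algebra_simps)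
qed simp

subsection \<open>Exponential weights\<close>

text \<open>The weights may be any reals. Besides probability vectors, differences of consecutive
  ones, of total mass 0, are averaged below.\<close>

definition wmean :: "nat \<Rightarrow> 'a set \<Rightarrow> ('a \<Rightarrow> real) \<Rightarrow> ('a \<Rightarrow> real vec) \<Rightarrow> real vec" where
  "wmean n N p Y = vec n (\<lambda>i. \<Sum>k\<in>N. p k * Y k $ i)"

lemma wmean_carrier [simp]: "wmean n N p Y \<in> carrier_vec n"
  and dim_wmean [simp]: "dim_vec (wmean n N p Y) = n"
  and index_wmean [simp]: "i < n \<Longrightarrow> wmean n N p Y $ i = (\<Sum>k\<in>N. p k * Y k $ i)"
  by (simp_all add: wmean_def)

lemma wmean_cong:
  "(\<And>k. k \<in> N \<Longrightarrow> p k = q k) \<Longrightarrow> (\<And>k. k \<in> N \<Longrightarrow> Y k = Z k) \<Longrightarrow> wmean n N p Y = wmean n N q Z"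
  by (simp add: wmean_def)

lemma scalar_prod_wmean:
  assumes "\<And>k. k \<in> N \<Longrightarrow> Y k \<in> carrier_vec n"
  shows "g \<bullet> wmean n N p Y = (\<Sum>k\<in>N. p k * (g \<bullet> Y k))"
proof -
  have "g \<bullet> wmean n N p Y = (\<Sum>i=0..<n. \<Sum>k\<in>N. p k * (g $ i * Y k $ i))"
    unfolding scalar_prod_def by (simp add: sum_distrib_left mult_ac)
  also have "\<dots> = (\<Sum>k\<in>N. \<Sum>i=0..<n. p k * (g $ i * Y k $ i))" by (rule sum.swap)
  also have "\<dots> = (\<Sum>k\<in>N. p k * (g \<bullet> Y k))"
    using carrier_vecD[OF assms] by (auto simp: scalar_prod_def sum_distrib_left intro!: sum.cong)
  finally show ?thesis .
qed

text \<open>By duality: the mean is paired with itself, Cauchy-Schwarz is applied to each term, and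
  one factor of its norm is cancelled.\<close>

lemma vnorm_wmean_le:
  assumes Y: "\<And>k. k \<in> N \<Longrightarrow> Y k \<in> carrier_vec n"
  shows "vnorm (wmean n N p Y) \<le> (\<Sum>k\<in>N. \<bar>p k\<bar> * vnorm (Y k))"
proof (cases "vnorm (wmean n N p Y) = 0")
  case True
  then show ?thesis by (simp add: sum_nonneg)
next
  case False
  let ?m = "wmean n N p Y"
  have "vnorm ?m * vnorm ?m = (\<Sum>k\<in>N. p k * (?m \<bullet> Y k))"
    by (simp flip: scalar_prod_wmean[OF Y] power2_eq_square add: scalar_prod_self)
  also have "\<dots> \<le> (\<Sum>k\<in>N. \<bar>p k\<bar> * (vnorm ?m * vnorm (Y k)))"
  proof (rule sum_mono)
    fix k assume k: "k \<in> N"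
    have "p k * (?m \<bullet> Y k) \<le> \<bar>p k\<bar> * \<bar>?m \<bullet> Y k\<bar>" by (simp flip: abs_mult)
    also have "\<dots> \<le> \<bar>p k\<bar> * (vnorm ?m * vnorm (Y k))"
      using carrier_vecD[OF Y[OF k]] by (intro mult_left_mono abs_scalar_prod_le) auto
    finally show "p k * (?m \<bullet> Y k) \<le> \<bar>p k\<bar> * (vnorm ?m * vnorm (Y k))" .
  qed
  also have "\<dots> = vnorm ?m * (\<Sum>k\<in>N. \<bar>p k\<bar> * vnorm (Y k))"
    by (simp add: sum_distrib_left mult_ac)
  finally show ?thesis using False by (simp add: order_less_le)
qed

lemma vnorm_convex_wmean_le:
  assumes "\<And>k. k \<in> N \<Longrightarrow> Y k \<in> vball n D" "\<And>k. k \<in> N \<Longrightarrow> 0 \<le> p k" "sum p N = 1"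
  shows "wmean n N p Y \<in> vball n D"
proof -
  have "vnorm (wmean n N p Y) \<le> (\<Sum>k\<in>N. \<bar>p k\<bar> * vnorm (Y k))"
    by (rule vnorm_wmean_le) (use assms in \<open>auto simp: vball_def\<close>)
  also have "\<dots> \<le> (\<Sum>k\<in>N. p k * D)"
    using assms by (intro sum_mono mult_mono) (auto simp: vball_def)
  also have "\<dots> = D" using assms by (simp flip: sum_distrib_right)
  finally show ?thesis by (simp add: vball_def)
qed

lemma mult_mat_wmean:
  assumes "M \<in> carrier_mat l n" and "\<And>k. k \<in> N \<Longrightarrow> Y k \<in> carrier_vec n"
  shows "M *\<^sub>v wmean n N p Y = wmean l N p (\<lambda>k. M *\<^sub>v Y k)"
  using assms by (intro eq_vecI) (auto simp: scalar_prod_wmean)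

lemma wmean_add:
  assumes "\<And>k. k \<in> N \<Longrightarrow> Z k \<in> carrier_vec n"
  shows "wmean n N p (\<lambda>k. Y k + Z k) = wmean n N p Y + wmean n N p Z"
  using carrier_vecD[OF assms] by (intro eq_vecI) (simp_all add: sum.distrib distrib_left cong: sum.cong_simp)

lemma wmean_const:
  assumes "v \<in> carrier_vec n"
  shows "wmean n N p (\<lambda>_. v) = sum p N \<cdot>\<^sub>v v"
  using assms by (intro eq_vecI) (auto simp: sum_distrib_right)

lemma wmean_diff_weights:
  "wmean n N (\<lambda>k. p k - q k) Y = wmean n N p Y - wmean n N q Y"
  by (intro eq_vecI) (simp_all add: sum_subtractf algebra_simps)

lemma wmean_append:
  assumes "\<And>k. k \<in> N \<Longrightarrow> Y k \<in> carrier_vec n" "\<And>k. k \<in> N \<Longrightarrow> Z k \<in> carrier_vec m"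
  shows "wmean (n + m) N p (\<lambda>k. Y k @\<^sub>v Z k) = wmean n N p Y @\<^sub>v wmean m N p Z"
  using carrier_vecD[OF assms(1)] carrier_vecD[OF assms(2)]
  by (intro eq_vecI) (auto intro!: sum.cong)

section \<open>One round of exponential weights under strong convexity\<close>

lemma exp_minus_le_quadratic:
  fixes x :: real
  assumes "\<bar>x\<bar> \<le> 1" shows "exp (- x) \<le> 1 - x + x\<^sup>2"
proof (cases "0 \<le> x")
  case True
  \<comment> \<open>The product equals \<open>1 + x ^ 3\<close>; with
    \<open>1 + x \<le> exp x\<close> this settles the nonnegative case.\<close>
  have "1 \<le> (1 - x + x\<^sup>2) * (1 + x)"
    using True by (simp add: algebra_simps power2_eq_square)
  also have "\<dots> \<le> (1 - x + x\<^sup>2) * exp x"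
  proof (intro mult_left_mono)
    have "0 \<le> (1 - x) + x\<^sup>2" using assms True by (intro add_nonneg_nonneg) auto
    then show "0 \<le> 1 - x + x\<^sup>2" .
  qed (simp add: exp_ge_add_one_self)
  finally show ?thesis by (simp add: exp_minus field_simps)
next
  case False
  then show ?thesis using exp_bound[of "- x"] assms by simp
qed

lemma abs_one_minus_exp_le:
  fixes x :: real
  assumes "\<bar>x\<bar> \<le> 1" shows "\<bar>1 - exp (- x)\<bar> \<le> 2 * \<bar>x\<bar>"
proof -
  have "x\<^sup>2 = \<bar>x\<bar> * \<bar>x\<bar>" by (simp add: power2_eq_square)
  also have "\<dots> \<le> \<bar>x\<bar>" using mult_left_mono[OF assms, of "\<bar>x\<bar>"] by simp
  finally have "exp (- x) \<le> 1 + 2 * \<bar>x\<bar>" using exp_minus_le_quadratic[OF assms] by linarith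
  moreover have "1 - x \<le> exp (- x)" using exp_ge_add_one_self[of "- x"] by simp
  ultimately show ?thesis by linarith
qed

text \<open>Everything is expanded around the mean \<open>m\<close> in the deviations
  \<open>h k = Y k - m\<close>. Their weighted mean is 0, which removes every first-order term: in
  the mixture loss the gradient term disappears, and in the motion of the mean each deviation meets
  a second one, so that \<open>V\<close> appears.\<close>

lemma exp_weights_round:
  fixes c :: "real vec \<Rightarrow> real" and p :: "'a \<Rightarrow> real"
  assumes p: "\<And>k. k \<in> N \<Longrightarrow> 0 \<le> p k" "sum p N = 1"
    and Y: "\<And>k. k \<in> N \<Longrightarrow> Y k \<in> vball n D"
    and lip: "\<And>y y'. y \<in> vball n D \<Longrightarrow> y' \<in> vball n D \<Longrightarrow> c y - c y' \<le> L * vnorm (y - y')"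
    and g: "g \<in> carrier_vec n" "vnorm g \<le> L"
    and sc: "\<And>y. y \<in> vball n D \<Longrightarrow>
      c m + g \<bullet> (y - m) + \<mu> / 2 * (vnorm (y - m))\<^sup>2 \<le> c y"
    and pos: "0 < L" "0 < \<mu>" "0 < \<eta>" and \<eta>: "16 * \<eta> * L\<^sup>2 \<le> \<mu>"
    and m: "m = wmean n N p Y"
    and V: "V = (\<Sum>k\<in>N. p k * (vnorm (Y k - m))\<^sup>2)"
    and S: "S = (\<Sum>k\<in>N. p k * exp (- \<eta> * c (Y k)))"
  shows "S \<le> exp (- \<eta> * (c m + \<mu> / 4 * V))"
    and "vnorm (wmean n N (\<lambda>k. p k - p k * exp (- \<eta> * c (Y k)) / S) Y) \<le> 4 * \<eta> * L * V"
proof -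
  have mb: "m \<in> vball n D" unfolding m by (rule vnorm_convex_wmean_le[OF Y p])
  have mc: "dim_vec m = n" by (simp add: m)
  have Yc: "Y k \<in> carrier_vec n" if "k \<in> N" for k using Y[OF that] by (simp add: vball_def)
  define h where "h k = Y k - m" for k
  define a where "a k = c (Y k) - c m" for k
  define e where "e k = exp (- \<eta> * a k)" for k
  have hc: "h k \<in> carrier_vec n" if "k \<in> N" for k
    using Yc[OF that] by (simp add: h_def m)
  have V0: "0 \<le> V" unfolding V using p by (intro sum_nonneg) auto
  have a_abs: "\<bar>a k\<bar> \<le> L * vnorm (h k)" if k: "k \<in> N" for k
    using lip[OF Y[OF k] mb] lip[OF mb Y[OF k]] vnorm_minus_commute[of m "Y k"] mc Yc[OF k]
    by (simp add: a_def h_def)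
  have gh: "\<bar>g \<bullet> h k\<bar> \<le> L * vnorm (h k)" if k: "k \<in> N" for k
    using abs_scalar_prod_le[of g "h k"] g hc[OF k] mult_right_mono[OF g(2), of "vnorm (h k)"] by simp
  have a_sc: "g \<bullet> h k + \<mu> / 2 * (vnorm (h k))\<^sup>2 \<le> a k" if k: "k \<in> N" for k
    using sc[OF Y[OF k]] by (simp add: a_def h_def)
  \<comment> \<open>Quadratic growth against linear growth: strong convexity and the Lipschitz bound
    together limit the deviations to \<open>4 * L / \<mu>\<close>. This replaces the diameter of the
    ball and is why \<open>\<eta>\<close> has to be compared only with
    \<open>\<mu> / L\<^sup>2\<close>.\<close>
  have \<mu>h: "\<mu> * vnorm (h k) \<le> 4 * L" if k: "k \<in> N" for k
  proof (cases "vnorm (h k) = 0")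
    case False
    have "\<mu> / 2 * (vnorm (h k))\<^sup>2 \<le> 2 * L * vnorm (h k)"
      using a_sc[OF k] a_abs[OF k] gh[OF k] by linarith
    then have "(\<mu> * vnorm (h k)) * vnorm (h k) \<le> (4 * L) * vnorm (h k)"
      by (simp add: power2_eq_square)
    then show ?thesis using False by (simp add: order_less_le)
  qed (use pos in simp)
  have small: "\<eta> * L * vnorm (h k) \<le> 1 / 4" if k: "k \<in> N" for k
  proof -
    have "(16 * \<eta> * L\<^sup>2) * vnorm (h k) \<le> \<mu> * vnorm (h k)" by (rule mult_right_mono[OF \<eta>]) simp
    also have "\<dots> \<le> 4 * L" by (rule \<mu>h[OF k])
    finally have "(4 * L) * (4 * (\<eta> * L * vnorm (h k))) \<le> (4 * L) * 1"
      by (simp add: power2_eq_square algebra_simps)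
    then show ?thesis using pos by (simp add: mult_ac)
  qed
  have \<eta>a: "\<bar>\<eta> * a k\<bar> \<le> \<eta> * L * vnorm (h k)" if k: "k \<in> N" for k
    using mult_left_mono[OF a_abs[OF k], of \<eta>] pos by (simp add: abs_mult mult_ac)
  \<comment> \<open>Dividing out the cost of the mean leaves exponents of modulus at most
    \<open>1 / 4\<close>, where the quadratic bound on \<open>exp\<close> applies.\<close>
  have e_eq: "exp (- \<eta> * c (Y k)) = exp (- \<eta> * c m) * e k" for k
    by (simp add: e_def a_def algebra_simps flip: exp_add)
  define S' where "S' = (\<Sum>k\<in>N. p k * e k)"
  have SS': "S = exp (- \<eta> * c m) * S'"
    unfolding S S'_def e_eq by (simp add: sum_distrib_left mult_ac)
  have h0: "wmean n N p h = 0\<^sub>v n"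
  proof (intro eq_vecI)
    fix i assume i: "i < dim_vec (0\<^sub>v n :: real vec)"
    have "(\<Sum>k\<in>N. p k * h k $ i) = (\<Sum>k\<in>N. p k * Y k $ i - p k * m $ i)"
      using i mc by (simp add: h_def algebra_simps)
    also have "\<dots> = m $ i - sum p N * m $ i"
      using i by (simp add: sum_subtractf m sum_distrib_right)
    finally show "wmean n N p h $ i = 0\<^sub>v n $ i" using i p by simp
  qed simp
  have pg: "(\<Sum>k\<in>N. p k * (g \<bullet> h k)) = 0"
    using scalar_prod_wmean[of N h n g p] hc h0 g by simp
  have Vh: "V = (\<Sum>k\<in>N. p k * (vnorm (h k))\<^sup>2)" by (simp add: V h_def)
  have "S' \<le> (\<Sum>k\<in>N. p k - \<eta> * (p k * (g \<bullet> h k)) - \<eta> * (\<mu> / 4) * (p k * (vnorm (h k))\<^sup>2))"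
    unfolding S'_def
  proof (rule sum_mono)
    fix k assume k: "k \<in> N"
    have "e k \<le> 1 - \<eta> * a k + (\<eta> * a k)\<^sup>2"
      using exp_minus_le_quadratic[of "\<eta> * a k"] \<eta>a[OF k] small[OF k] by (simp add: e_def)
    \<comment> \<open>The second-order term of the exponential is charged to half of the gain
      \<open>\<mu> / 2\<close> from strong convexity; the other half is the slack
      \<open>\<mu> / 4\<close> in the conclusion.\<close>
    moreover have "(\<eta> * a k)\<^sup>2 \<le> \<eta> * (\<mu> / 4) * (vnorm (h k))\<^sup>2"
    proof -
      have "(\<eta> * a k)\<^sup>2 \<le> (\<eta> * L * vnorm (h k))\<^sup>2"
        using power_mono[OF \<eta>a[OF k], of 2] by simp
      also have "\<dots> = (\<eta> * (vnorm (h k))\<^sup>2) * (\<eta> * L\<^sup>2)" by (simp add: power2_eq_square mult_ac)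
      also have "\<dots> \<le> (\<eta> * (vnorm (h k))\<^sup>2) * (\<mu> / 4)"
        using \<eta> pos by (intro mult_left_mono) auto
      finally show ?thesis by (simp add: mult_ac)
    qed
    moreover have "\<eta> * (g \<bullet> h k + \<mu> / 2 * (vnorm (h k))\<^sup>2) \<le> \<eta> * a k"
      using a_sc[OF k] pos by (intro mult_left_mono) auto
    ultimately have "e k \<le> 1 - \<eta> * (g \<bullet> h k) - \<eta> * (\<mu> / 4) * (vnorm (h k))\<^sup>2"
      by (simp add: algebra_simps)
    from mult_left_mono[OF this p(1)[OF k]]
    show "p k * e k \<le> p k - \<eta> * (p k * (g \<bullet> h k)) - \<eta> * (\<mu> / 4) * (p k * (vnorm (h k))\<^sup>2)"
      by (simp add: algebra_simps)
  qed
  also have "\<dots> = 1 - \<eta> * (\<mu> / 4) * V"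
    using p(2) pg by (simp only: sum_subtractf Vh sum_distrib_left[symmetric] mult_zero_right diff_0_right)
  also have "\<dots> \<le> exp (- (\<eta> * (\<mu> / 4) * V))" using exp_ge_add_one_self[of "- (\<eta> * (\<mu> / 4) * V)"] by simp
  finally have "S \<le> exp (- \<eta> * c m) * exp (- (\<eta> * (\<mu> / 4) * V))"
    unfolding SS' by (intro mult_left_mono) auto
  also have "\<dots> = exp (- \<eta> * (c m + \<mu> / 4 * V))" by (simp add: algebra_simps flip: exp_add)
  finally show "S \<le> exp (- \<eta> * (c m + \<mu> / 4 * V))" .
  have S'_half: "1 / 2 \<le> S'"
  proof -
    have "(\<Sum>k\<in>N. p k * (1 / 2)) \<le> S'"
      unfolding S'_def
    proof (intro sum_mono mult_left_mono p(1))
      fix k assume k: "k \<in> N"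
      have "1 - \<eta> * a k \<le> e k" using exp_ge_add_one_self[of "- (\<eta> * a k)"] by (simp add: e_def)
      then show "1 / 2 \<le> e k" using \<eta>a[OF k] small[OF k] by linarith
    qed
    then show ?thesis using p(2) by (simp flip: sum_divide_distrib)
  qed
  \<comment> \<open>Two exchanges leave the mean unchanged: \<open>Y\<close> becomes
    \<open>h\<close> because the weight change has total mass 0, and \<open>S' - e k\<close> becomes
    \<open>1 - e k\<close> because \<open>h\<close> has weighted mean 0. The new factor
    \<open>1 - e k\<close> is itself of order \<open>\<eta> * L * vnorm (h k)\<close>.\<close>
  have "wmean n N (\<lambda>k. p k - p k * exp (- \<eta> * c (Y k)) / S) Y = wmean n N (\<lambda>k. p k * (1 - e k) / S') h"
  proof (intro eq_vecI)
    fix i assume "i < dim_vec (wmean n N (\<lambda>k. p k * (1 - e k) / S') h)"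
    then have i: "i < n" by simp
    let ?E = "\<Sum>k\<in>N. p k * e k * Y k $ i"
    have "(\<Sum>k\<in>N. (p k - p k * exp (- \<eta> * c (Y k)) / S) * Y k $ i)
        = (\<Sum>k\<in>N. p k * Y k $ i - p k * e k * Y k $ i / S')"
      unfolding SS' e_eq by (intro sum.cong) (simp_all add: algebra_simps)
    also have "\<dots> = m $ i - ?E / S'"
      using i by (simp add: sum_subtractf m sum_divide_distrib)
    also have "\<dots> = (m $ i - ?E - (m $ i - S' * m $ i)) / S'"
      using S'_half by (simp add: field_simps)
    also have "m $ i - ?E - (m $ i - S' * m $ i)
        = (\<Sum>k\<in>N. p k * Y k $ i - p k * e k * Y k $ i - (p k * m $ i - p k * e k * m $ i))"
      using i p(2) by (simp add: sum_subtractf S'_def m flip: sum_distrib_right)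
    also have "\<dots> / S' = (\<Sum>k\<in>N. p k * (1 - e k) / S' * h k $ i)"
      unfolding sum_divide_distrib using i mc by (intro sum.cong) (simp_all add: h_def algebra_simps diff_divide_distrib add_divide_distrib)
    finally show "wmean n N (\<lambda>k. p k - p k * exp (- \<eta> * c (Y k)) / S) Y $ i
        = wmean n N (\<lambda>k. p k * (1 - e k) / S') h $ i" using i by simp
  qed simp
  then have "vnorm (wmean n N (\<lambda>k. p k - p k * exp (- \<eta> * c (Y k)) / S) Y)
      \<le> (\<Sum>k\<in>N. \<bar>p k * (1 - e k) / S'\<bar> * vnorm (h k))"
    using vnorm_wmean_le[of N h n "\<lambda>k. p k * (1 - e k) / S'", OF hc] by (simp only:)
  also have "\<dots> \<le> (\<Sum>k\<in>N. 4 * \<eta> * L * (p k * (vnorm (h k))\<^sup>2))"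
  proof (rule sum_mono)
    fix k assume k: "k \<in> N"
    have "\<bar>1 - e k\<bar> \<le> 2 * (\<eta> * L * vnorm (h k))"
      using abs_one_minus_exp_le[of "\<eta> * a k"] \<eta>a[OF k] small[OF k] by (simp add: e_def)
    moreover have "1 / S' \<le> 2" using S'_half by (simp add: field_simps)
    ultimately have "\<bar>1 - e k\<bar> * (1 / S') \<le> 2 * (\<eta> * L * vnorm (h k)) * 2"
      using S'_half pos by (intro mult_mono) auto
    then have "(p k * vnorm (h k)) * (\<bar>1 - e k\<bar> * (1 / S')) \<le> (p k * vnorm (h k)) * (2 * (\<eta> * L * vnorm (h k)) * 2)"
      using p(1)[OF k] by (intro mult_left_mono) auto
    moreover have "\<bar>p k * (1 - e k) / S'\<bar> * vnorm (h k) = (p k * vnorm (h k)) * (\<bar>1 - e k\<bar> * (1 / S'))"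
      using p(1)[OF k] S'_half by (simp add: abs_mult)
    ultimately show "\<bar>p k * (1 - e k) / S'\<bar> * vnorm (h k) \<le> 4 * \<eta> * L * (p k * (vnorm (h k))\<^sup>2)"
      by (simp add: power2_eq_square mult_ac)
  qed
  also have "\<dots> = 4 * \<eta> * L * V" by (simp add: Vh sum_distrib_left)
  finally show "vnorm (wmean n N (\<lambda>k. p k - p k * exp (- \<eta> * c (Y k)) / S) Y) \<le> 4 * \<eta> * L * V" .
qed

section \<open>From gradients to subgradients and Lipschitz bounds\<close>

text \<open>Regularity speaks of gradients, strong convexity of global subgradients. If the
  subgradient inequality failed at \<open>z\<close>, convexity would carry the failure, scaled by
  \<open>a\<close>, to the point at fraction \<open>a\<close> of the segment from \<open>y\<close>
  to \<open>z\<close>, contradicting the first-order expansion for small \<open>a\<close>.\<close>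

lemma has_gradient_subdiff:
  assumes conv: "convex_cost n c" and grad: "has_gradient n c g y" and y: "y \<in> carrier_vec n"
  shows "g \<in> subdiff n c y"
proof -
  have g: "g \<in> carrier_vec n" using grad by (simp add: has_gradient_def)
  have "c y + g \<bullet> (z - y) \<le> c z" if z: "z \<in> carrier_vec n" for z
  proof (rule ccontr)
    let ?h = "z - y"
    assume "\<not> ?thesis"
    then have \<delta>: "0 < c y + g \<bullet> ?h - c z" by simp
    \<comment> \<open>The tolerance makes \<open>e * vnorm ?h\<close> smaller than the supposed gap;
      the summand 1 keeps the denominator positive when \<open>z = y\<close>.\<close>
    define e where "e = (c y + g \<bullet> ?h - c z) / (2 * (vnorm ?h + 1))"
    have h1: "0 < vnorm ?h + 1" by (simp add: add_nonneg_pos)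
    have less: "vnorm ?h < 2 * (vnorm ?h + 1)"
      by (simp add: algebra_simps add_pos_nonneg)
    have e: "0 < e" using \<delta> h1 by (simp add: e_def)
    have e_small: "e * vnorm ?h < c y + g \<bullet> ?h - c z"
    proof -
      have "e * vnorm ?h < e * (2 * (vnorm ?h + 1))"
        by (rule mult_strict_left_mono[OF less e])
      then show ?thesis using h1 by (simp add: e_def)
    qed
    obtain d where d: "0 < d"
      and lin: "\<And>h. h \<in> carrier_vec n \<Longrightarrow> vnorm h < d \<Longrightarrow> \<bar>c (y + h) - c y - g \<bullet> h\<bar> \<le> e * vnorm h"
      using grad e unfolding has_gradient_def by blast
    define a where "a = min 1 (d / (2 * (vnorm ?h + 1)))"
    have a: "0 < a" "a \<le> 1" using d h1 by (simp_all add: a_def)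
    have "a * vnorm ?h \<le> d / (2 * (vnorm ?h + 1)) * vnorm ?h"
      by (intro mult_right_mono) (simp_all add: a_def)
    also have "\<dots> < d"
    proof -
      have "d * vnorm ?h < d * (2 * (vnorm ?h + 1))"
        by (rule mult_strict_left_mono[OF less d])
      then show ?thesis using h1 by (simp add: divide_less_eq)
    qed
    finally have ad: "vnorm (a \<cdot>\<^sub>v ?h) < d" using a by (simp add: vnorm_smult)
    have hc: "?h \<in> carrier_vec n" using y z by simp
    have gs: "g \<bullet> (a \<cdot>\<^sub>v ?h) = a * (g \<bullet> ?h)" using g hc by simp
    have "y + a \<cdot>\<^sub>v ?h = (1 - a) \<cdot>\<^sub>v y + a \<cdot>\<^sub>v z"
      using y z by (intro eq_vecI) (auto simp: algebra_simps)
    then have "c (y + a \<cdot>\<^sub>v ?h) \<le> (1 - a) * c y + a * c z"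
      using conv y z a unfolding convex_cost_def by auto
    moreover have "\<bar>c (y + a \<cdot>\<^sub>v ?h) - c y - a * (g \<bullet> ?h)\<bar> \<le> e * (a * vnorm ?h)"
      using lin[of "a \<cdot>\<^sub>v ?h"] ad hc a by (simp add: gs vnorm_smult)
    ultimately have "a * (c y + g \<bullet> ?h - c z) \<le> a * (e * vnorm ?h)"
      by (simp add: algebra_simps abs_le_iff)
    then show False using a e_small by simp
  qed
  then show ?thesis using g by (simp add: subdiff_def)
qed

lemma regular_cost_subgradient:
  assumes "regular_cost n G D c" "y \<in> vball n D"
  obtains g where "g \<in> subdiff n c y" "vnorm g \<le> G * D"
  using assms has_gradient_subdiff unfolding regular_cost_def vball_def by blast

lemma regular_cost_lipschitz:
  assumes reg: "regular_cost n G D c" and y: "y \<in> vball n D" and y': "y' \<in> vball n D"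
  shows "c y - c y' \<le> G * D * vnorm (y - y')"
proof -
  obtain g where g: "g \<in> subdiff n c y" "vnorm g \<le> G * D" by (rule regular_cost_subgradient[OF reg y])
  have dims: "y \<in> carrier_vec n" "y' \<in> carrier_vec n" using y y' by (auto simp: vball_def)
  have "c y + g \<bullet> (y' - y) \<le> c y'" using g dims by (simp add: subdiff_def)
  moreover have "\<bar>g \<bullet> (y' - y)\<bar> \<le> vnorm g * vnorm (y' - y)"
    using g dims by (intro abs_scalar_prod_le) (auto simp: subdiff_def)
  moreover have "\<dots> \<le> G * D * vnorm (y - y')"
    unfolding vnorm_minus_commute[of y' y, unfolded carrier_vecD[OF dims(1)] carrier_vecD[OF dims(2)], OF refl]
    by (intro mult_right_mono g) simp
  ultimately show ?thesis by linarith
qed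

text \<open>The weights \<open>ew_weight\<close> with the costs of the candidates abstracted to a
  table \<open>f\<close>, so that the potential argument involves no dynamics.\<close>

definition hedge :: "'a set \<Rightarrow> real \<Rightarrow> (nat \<Rightarrow> 'a \<Rightarrow> real) \<Rightarrow> nat \<Rightarrow> 'a \<Rightarrow> real" where
  "hedge N \<eta> f t k = exp (- \<eta> * (\<Sum>s\<in>{1..<t}. f s k)) / (\<Sum>k'\<in>N. exp (- \<eta> * (\<Sum>s\<in>{1..<t}. f s k')))"

lemma exp_cumulative_loss_Suc:
  fixes f :: "nat \<Rightarrow> 'a \<Rightarrow> real"
  assumes "1 \<le> t"
  shows "exp (- \<eta> * (\<Sum>s\<in>{1..<Suc t}. f s k)) = exp (- \<eta> * (\<Sum>s\<in>{1..<t}. f s k)) * exp (- \<eta> * f t k)"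
  using assms by (simp add: sum.atLeastLessThan_Suc distrib_left flip: exp_add)

context
  fixes N :: "'a set"
  assumes fin: "finite N" and ne: "N \<noteq> {}"
begin

lemma partition_pos: "0 < (\<Sum>k\<in>N. exp (g k :: real))"
  by (rule sum_pos[OF fin ne]) simp

lemma hedge_nonneg: "0 \<le> hedge N \<eta> f t k"
  unfolding hedge_def using partition_pos by (intro divide_nonneg_nonneg) (simp_all add: less_imp_le)

lemma sum_hedge: "sum (hedge N \<eta> f t) N = 1"
  unfolding hedge_def using partition_pos[of "\<lambda>k. - \<eta> * (\<Sum>s\<in>{1..<t}. f s k)"]
  by (simp flip: sum_divide_distrib)

text \<open>The mixture sum of a round is the ratio of consecutive partition functions; this makes
  the analysis telescope.\<close>

lemma hedge_partition:
  assumes "1 \<le> t"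
  shows "(\<Sum>k\<in>N. hedge N \<eta> f t k * exp (- \<eta> * f t k)) * (\<Sum>k\<in>N. exp (- \<eta> * (\<Sum>s\<in>{1..<t}. f s k)))
    = (\<Sum>k\<in>N. exp (- \<eta> * (\<Sum>s\<in>{1..<Suc t}. f s k)))"
proof -
  let ?Z = "\<Sum>k\<in>N. exp (- \<eta> * (\<Sum>s\<in>{1..<t}. f s k))"
  have "?Z \<noteq> 0" using partition_pos[of "\<lambda>k. - \<eta> * (\<Sum>s\<in>{1..<t}. f s k)"] by simp
  then have "hedge N \<eta> f t k * exp (- \<eta> * f t k) * ?Z = exp (- \<eta> * (\<Sum>s\<in>{1..<Suc t}. f s k))" for k
    unfolding exp_cumulative_loss_Suc[OF assms] by (simp add: hedge_def)
  then show ?thesis by (simp only: sum_distrib_right)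
qed

lemma hedge_Suc:
  assumes "1 \<le> t"
  shows "hedge N \<eta> f (Suc t) k
    = hedge N \<eta> f t k * exp (- \<eta> * f t k) / (\<Sum>k\<in>N. hedge N \<eta> f t k * exp (- \<eta> * f t k))"
proof -
  let ?Z = "\<Sum>k\<in>N. exp (- \<eta> * (\<Sum>s\<in>{1..<t}. f s k))"
  have Z: "?Z > 0" by (rule partition_pos)
  have "hedge N \<eta> f (Suc t) k
      = exp (- \<eta> * (\<Sum>s\<in>{1..<Suc t}. f s k)) / ((\<Sum>k\<in>N. hedge N \<eta> f t k * exp (- \<eta> * f t k)) * ?Z)"
    unfolding hedge_partition[OF assms] by (simp add: hedge_def)
  also have "exp (- \<eta> * (\<Sum>s\<in>{1..<Suc t}. f s k)) = hedge N \<eta> f t k * exp (- \<eta> * f t k) * ?Z"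
  proof -
    show ?thesis unfolding exp_cumulative_loss_Suc[OF assms] using Z by (simp add: hedge_def)
  qed
  finally show ?thesis using Z by simp
qed

text \<open>The partition function starts at \<open>card N\<close>, loses at least the factor
  \<open>exp (- \<eta> * b t)\<close> in each round, and finally still dominates the weight of
  \<open>k\<close>. Leaving \<open>b\<close> free allows the variance slack to be carried along with
  the cost of the mean.\<close>

lemma hedge_regret:
  assumes \<eta>: "0 < \<eta>" and k: "k \<in> N"
    and mix: "\<And>t. t \<in> {1..T} \<Longrightarrow> (\<Sum>k\<in>N. hedge N \<eta> f t k * exp (- \<eta> * f t k)) \<le> exp (- \<eta> * b t)"
  shows "(\<Sum>t\<in>{1..T}. b t) \<le> (\<Sum>t\<in>{1..T}. f t k) + ln (real (card N)) / \<eta>"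
proof -
  define Z where "Z t = (\<Sum>k\<in>N. exp (- \<eta> * (\<Sum>s\<in>{1..<t}. f s k)))" for t
  have "Z (Suc T) \<le> real (card N) * exp (- \<eta> * (\<Sum>t\<in>{1..T}. b t))"
    using mix
  proof (induction T)
    case 0
    then show ?case by (simp add: Z_def)
  next
    case (Suc T)
    have "Z (Suc (Suc T)) = (\<Sum>k\<in>N. hedge N \<eta> f (Suc T) k * exp (- \<eta> * f (Suc T) k)) * Z (Suc T)"
      unfolding Z_def by (rule hedge_partition[symmetric]) simp
    also have "\<dots> \<le> exp (- \<eta> * b (Suc T)) * (real (card N) * exp (- \<eta> * (\<Sum>t\<in>{1..T}. b t)))"
      by (intro mult_mono Suc) (use Suc.prems partition_pos in \<open>auto simp: Z_def intro!: less_imp_le\<close>)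
    also have "\<dots> = real (card N) * exp (- \<eta> * (\<Sum>t\<in>{1..Suc T}. b t))"
      by (simp add: distrib_left flip: exp_add)
    finally show ?case .
  qed
  moreover have "exp (- \<eta> * (\<Sum>t\<in>{1..T}. f t k)) \<le> Z (Suc T)"
    unfolding Z_def atLeastLessThanSuc_atLeastAtMost
    by (rule member_le_sum[OF k _ fin, of "\<lambda>k. exp (- \<eta> * (\<Sum>t\<in>{1..T}. f t k))"]) simp
  ultimately have "exp (- \<eta> * (\<Sum>t\<in>{1..T}. f t k)) \<le> real (card N) * exp (- \<eta> * (\<Sum>t\<in>{1..T}. b t))"
    by linarith
  then have "ln (exp (- \<eta> * (\<Sum>t\<in>{1..T}. f t k))) \<le> ln (real (card N) * exp (- \<eta> * (\<Sum>t\<in>{1..T}. b t)))"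
    by (rule ln_mono) simp
  also have "\<dots> = ln (real (card N)) - \<eta> * (\<Sum>t\<in>{1..T}. b t)"
    using fin ne by (subst ln_mult_pos) (simp_all add: card_gt_0_iff)
  finally have "\<eta> * (\<Sum>t\<in>{1..T}. b t) \<le> \<eta> * (\<Sum>t\<in>{1..T}. f t k) + ln (real (card N))" by simp
  then show ?thesis using \<eta> by (simp add: field_simps)
qed

end

subsection \<open>Covers of the policy class\<close>

text \<open>Two geometric series, one for each sign, with 0 counted twice. The bound is uniform in
  \<open>M\<close>, which serves only to keep the index set finite.\<close>

lemma sum_power_abs_int_le:
  fixes q :: real
  assumes "0 \<le> q" "q < 1"
  shows "(\<Sum>z\<in>{- int M..int M}. q ^ nat \<bar>z\<bar>) \<le> 2 / (1 - q)"
proof -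
  have geo: "(\<Sum>k\<le>M. q ^ k) \<le> 1 / (1 - q)"
  proof -
    have "(1 - q) * (\<Sum>k\<le>M. q ^ k) = 1 - q ^ Suc M"
      using one_diff_power_eq[of q "Suc M"] by (simp only: lessThan_Suc_atMost)
    also have "\<dots> \<le> 1" using assms by simp
    finally have "(1 - q) * (\<Sum>k\<le>M. q ^ k) \<le> 1" .
    then show ?thesis using assms by (simp add: field_simps)
  qed
  have "(\<Sum>z\<in>{- int M..int M}. q ^ nat \<bar>z\<bar>) \<le> (\<Sum>z\<in>int ` {..M} \<union> (\<lambda>k. - int k) ` {..M}. q ^ nat \<bar>z\<bar>)"
  proof (rule sum_mono2)
    show "{- int M..int M} \<subseteq> int ` {..M} \<union> (\<lambda>k. - int k) ` {..M}"
    proof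
      fix z assume "z \<in> {- int M..int M}"
      then have "(z = int (nat z) \<and> nat z \<le> M) \<or> (z = - int (nat (- z)) \<and> nat (- z) \<le> M)" by auto
      then show "z \<in> int ` {..M} \<union> (\<lambda>k. - int k) ` {..M}" by blast
    qed
  qed (use assms in auto)
  also have "\<dots> \<le> (\<Sum>z\<in>int ` {..M}. q ^ nat \<bar>z\<bar>) + (\<Sum>z\<in>(\<lambda>k. - int k) ` {..M}. q ^ nat \<bar>z\<bar>)"
    using assms by (subst sum.union_inter[symmetric]) (auto intro!: sum_nonneg)
  also have "\<dots> = 2 * (\<Sum>k\<le>M. q ^ k)"
    by (subst (1 2) sum.reindex) (auto simp: inj_on_def)
  also have "\<dots> \<le> 2 / (1 - q)" using geo by simp
  finally show ?thesis .
qed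

text \<open>A Chernoff-type count: weigh \<open>f\<close> by \<open>q\<close> to the power \<open>\<Sum>\<bar>f i\<bar>\<close> with \<open>q = \<rho> / (1 + \<rho>)\<close>.\<close>

lemma card_int_l1_ball_le:
  fixes S :: "('i \<Rightarrow> int) set" and \<rho> :: real
  assumes I: "finite I" and \<rho>: "0 < \<rho>" and ext: "S \<subseteq> extensional I"
    and l1: "\<And>f. f \<in> S \<Longrightarrow> (\<Sum>i\<in>I. \<bar>real_of_int (f i)\<bar>) \<le> real (card I) * \<rho>"
  shows "finite S" and "real (card S) \<le> (6 * (1 + \<rho>)) ^ card I"
proof -
  define M where "M = nat \<lfloor>real (card I) * \<rho>\<rfloor>"
  define q where "q = \<rho> / (1 + \<rho>)"
  have q: "0 < q" "q < 1" using \<rho> by (simp_all add: q_def)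
  let ?P = "PiE I (\<lambda>_. {- int M..int M})"
  have sub: "S \<subseteq> ?P"
  proof
    fix f assume f: "f \<in> S"
    have "f i \<in> {- int M..int M}" if i: "i \<in> I" for i
    proof -
      have "\<bar>real_of_int (f i)\<bar> \<le> real (card I) * \<rho>"
        using member_le_sum[OF i, of "\<lambda>i. \<bar>real_of_int (f i)\<bar>"] I l1[OF f] by simp
      then have "\<bar>f i\<bar> \<le> \<lfloor>real (card I) * \<rho>\<rfloor>" by (simp add: le_floor_iff)
      also have "\<dots> \<le> int M" by (simp add: M_def)
      finally show ?thesis by auto
    qed
    then show "f \<in> ?P" using ext f by (auto simp: PiE_def)
  qed
  have finP: "finite ?P" using I by (intro finite_PiE) auto
  then show "finite S" using sub finite_subset by blast
  \<comment> \<open>The choice of \<open>q\<close> gives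
    \<open>1 / q = 1 + 1 / \<rho> \<le> exp (1 / \<rho>)\<close>, so a point of \<open>l1\<close>
    norm at most \<open>card I * \<rho>\<close> has weight at least
    \<open>exp (- card I)\<close>.\<close>
  have weight: "1 \<le> exp (real (card I)) * (\<Prod>i\<in>I. q ^ nat \<bar>f i\<bar>)" if f: "f \<in> S" for f
  proof -
    let ?s = "\<Sum>i\<in>I. nat \<bar>f i\<bar>"
    have s: "real ?s \<le> real (card I) * \<rho>" using l1[OF f] by simp
    have "(1 + 1 / \<rho>) ^ ?s \<le> exp (1 / \<rho>) ^ ?s"
      using \<rho> by (intro power_mono) (simp_all add: exp_ge_add_one_self)
    also have "\<dots> = exp (real ?s / \<rho>)" by (simp flip: exp_of_nat_mult)
    also have "\<dots> \<le> exp (real (card I))" using s \<rho> by (simp add: pos_divide_le_eq del: of_nat_sum)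
    finally have "(1 + 1 / \<rho>) ^ ?s * q ^ ?s \<le> exp (real (card I)) * q ^ ?s"
      using q by (intro mult_right_mono) auto
    also have "(1 + 1 / \<rho>) ^ ?s * q ^ ?s = ((1 + 1 / \<rho>) * q) ^ ?s" by (simp only: power_mult_distrib)
    also have "1 + 1 / \<rho> = (1 + \<rho>) / \<rho>" using \<rho> by (simp add: add_divide_distrib)
    also have "(1 + \<rho>) / \<rho> * q = 1" using \<rho> by (simp add: q_def)
    finally show ?thesis by (simp add: power_sum)
  qed
  have "real (card S) = (\<Sum>f\<in>S. 1)" by simp
  also have "\<dots> \<le> (\<Sum>f\<in>S. exp (real (card I)) * (\<Prod>i\<in>I. q ^ nat \<bar>f i\<bar>))"
    by (rule sum_mono[OF weight])
  also have "\<dots> \<le> (\<Sum>f\<in>?P. exp (real (card I)) * (\<Prod>i\<in>I. q ^ nat \<bar>f i\<bar>))"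
    using q by (intro sum_mono2 finP sub) (auto intro!: mult_nonneg_nonneg prod_nonneg)
  also have "\<dots> = exp (real (card I)) * (\<Prod>i\<in>I. \<Sum>z\<in>{- int M..int M}. q ^ nat \<bar>z\<bar>)"
    using I by (subst prod_sum_PiE) (auto simp: sum_distrib_left)
  also have "\<dots> \<le> exp (real (card I)) * (\<Prod>i\<in>I. 2 / (1 - q))"
    using sum_power_abs_int_le[of q M] q by (intro mult_left_mono prod_mono) (auto intro!: sum_nonneg)
  \<comment> \<open>Each coordinate pays \<open>exp 1\<close> for the weight and
    \<open>2 / (1 - q) = 2 * (1 + \<rho>)\<close> for the series; bounding \<open>exp 1\<close> by 3
    gives the constant 6.\<close>
  also have "\<dots> = (exp 1 * (2 * (1 + \<rho>))) ^ card I"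
  proof -
    have "2 / (1 - q) = 2 * (1 + \<rho>)" using \<rho> by (simp add: q_def field_simps)
    then show ?thesis by (simp add: power_mult_distrib flip: exp_of_nat_mult)
  qed
  also have "\<dots> \<le> (3 * (2 * (1 + \<rho>))) ^ card I"
    using \<rho> exp_le by (intro power_mono mult_right_mono) auto
  finally show "real (card S) \<le> (6 * (1 + \<rho>)) ^ card I" by (simp add: mult.assoc[symmetric])
qed

text \<open>Rounding towards zero does not increase absolute values, so codes of policies stay in an \<open>l\<^sub>1\<close> ball.\<close>

definition trunc_int :: "real \<Rightarrow> int" where
  "trunc_int x = (if 0 \<le> x then \<lfloor>x\<rfloor> else - \<lfloor>- x\<rfloor>)"

lemma abs_trunc_int_le: "\<bar>real_of_int (trunc_int x)\<bar> \<le> \<bar>x\<bar>"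
  using of_int_floor_le[of x] of_int_floor_le[of "- x"]
  by (auto simp: trunc_int_def)

text \<open>The bound is 2 rather than 1 because the whole interval from -1 to 1 is sent to
  0.\<close>

lemma trunc_int_eq_imp_close: "trunc_int x = trunc_int y \<Longrightarrow> \<bar>x - y\<bar> \<le> 2"
  using floor_correct[of x] floor_correct[of y] floor_correct[of "- x"] floor_correct[of "- y"]
    zero_le_floor[of x] zero_le_floor[of y] zero_le_floor[of "- x"] zero_le_floor[of "- y"]
  unfolding trunc_int_def abs_le_iff by (auto split: if_splits) linarith+

text \<open>Each policy is coded by its entries rounded at scale \<open>\<delta>\<close>. A common
  code forces closeness in Frobenius norm and so in operator norm, while the Frobenius radius of the
  class confines the codes to an \<open>l1\<close> ball that \<open>card_int_l1_ball_le\<close>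
  counts.\<close>

lemma finite_cover_exists:
  fixes \<K> :: "real mat set"
  assumes \<K>: "\<K> \<subseteq> carrier_mat r l" and op: "\<And>K. K \<in> \<K> \<Longrightarrow> op_norm K \<le> \<kappa>"
    and pos: "0 < \<kappa>" "0 < \<epsilon>" "1 \<le> r" "1 \<le> l"
  shows "\<exists>N. finite_cover \<epsilon> N \<K> \<and>
    real (card N) \<le> (6 * (1 + 2 * (\<kappa> * sqrt (real (min r l))) / \<epsilon>)) ^ (r * l)"
proof -
  let ?I = "{..<r} \<times> {..<l}"
  define n where "n = real (r * l)"
  let ?R = "\<kappa> * sqrt (real (min r l))"
  have cI: "real (card ?I) = n" by (simp add: n_def)
  have n: "0 < n" using pos by (simp add: n_def)
  \<comment> \<open>Entries with equal codes differ by at most \<open>2 * \<delta>\<close>, hence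
    matrices by at most \<open>2 * \<delta> * sqrt n = \<epsilon>\<close> in Frobenius norm.\<close>
  define \<delta> where "\<delta> = \<epsilon> / (2 * sqrt n)"
  have \<delta>: "0 < \<delta>" using pos n by (simp add: \<delta>_def)
  define code where "code K = restrict (\<lambda>p. trunc_int (K $$ p / \<delta>)) ?I" for K :: "real mat"
  have R: "0 < ?R" using pos by simp
  have \<rho>: "0 < 2 * ?R / \<epsilon>" using R pos by simp
  have frob: "(\<Sum>p\<in>?I. (K $$ p)\<^sup>2) \<le> ?R\<^sup>2" if K: "K \<in> \<K>" for K
  proof -
    have Kc: "dim_row K = r" "dim_col K = l" using \<K> K by auto
    have "(\<Sum>p\<in>?I. (K $$ p)\<^sup>2) \<le> real (min r l) * (op_norm K)\<^sup>2"
      using frobenius_le_op_norm[of K] Kc by (simp add: sum.cartesian_product)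
    also have "\<dots> \<le> real (min r l) * \<kappa>\<^sup>2"
      using op[OF K] by (intro mult_left_mono power_mono) auto
    also have "\<dots> = ?R\<^sup>2" by (simp add: power_mult_distrib)
    finally show ?thesis .
  qed
  have l1: "(\<Sum>p\<in>?I. \<bar>real_of_int (code K p)\<bar>) \<le> real (card ?I) * (2 * ?R / \<epsilon>)" if K: "K \<in> \<K>" for K
  proof -
    have "(\<Sum>p\<in>?I. \<bar>real_of_int (code K p)\<bar>) \<le> (\<Sum>p\<in>?I. \<bar>K $$ p\<bar> / \<delta>)"
    proof (rule sum_mono)
      fix p assume "p \<in> ?I"
      then show "\<bar>real_of_int (code K p)\<bar> \<le> \<bar>K $$ p\<bar> / \<delta>"
        using abs_trunc_int_le[of "K $$ p / \<delta>"] \<delta> by (simp add: code_def)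
    qed
    \<comment> \<open>Cauchy-Schwarz against the constant 1 passes from the Frobenius to the
      \<open>l1\<close> norm. Its factor \<open>sqrt n\<close> and the one in
      \<open>1 / \<delta>\<close> combine to \<open>n\<close>, so the average size of a code entry
      does not grow with \<open>n\<close> beyond what is in \<open>?R\<close>.\<close>
    also have "\<dots> = (\<Sum>p\<in>?I. \<bar>1\<bar> * \<bar>K $$ p\<bar>) / \<delta>" by (simp add: sum_divide_distrib)
    also have "\<dots> \<le> L2_set (\<lambda>_. 1) ?I * L2_set (($$) K) ?I / \<delta>"
      using \<delta> by (intro divide_right_mono L2_set_mult_ineq) auto
    also have "\<dots> \<le> sqrt n * ?R / \<delta>"
    proof (intro divide_right_mono mult_mono)
      show "L2_set (\<lambda>_. 1) ?I \<le> sqrt n" by (simp add: L2_set_constant n_def)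
      have "L2_set (($$) K) ?I \<le> sqrt (?R\<^sup>2)"
        unfolding L2_set_def by (rule real_sqrt_le_mono[OF frob[OF K]])
      then show "L2_set (($$) K) ?I \<le> ?R" using R by simp
    qed (use \<delta> n in auto)
    also have "\<dots> = (sqrt n * sqrt n) * (2 * ?R / \<epsilon>)"
      unfolding \<delta>_def by simp
    also have "sqrt n * sqrt n = real (card ?I)" unfolding cI using n by simp
    finally show ?thesis .
  qed
  have count: "finite (code ` \<K>)" "real (card (code ` \<K>)) \<le> (6 * (1 + 2 * ?R / \<epsilon>)) ^ card ?I"
    by (rule card_int_l1_ball_le[of ?I "2 * ?R / \<epsilon>"]; use \<rho> l1 in \<open>auto simp: code_def\<close>)+
  \<comment> \<open>One representative for each occurring code: the centres then lie in the class
    itself, as \<open>finite_cover\<close> demands.\<close>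
  define N where "N = inv_into \<K> code ` code ` \<K>"
  have "real (card N) \<le> real (card (code ` \<K>))"
    unfolding N_def using card_image_le[OF count(1)] by simp
  moreover have "finite_cover \<epsilon> N \<K>"
    unfolding finite_cover_def
  proof (intro conjI ballI)
    show "finite N" unfolding N_def using count(1) by simp
    show "N \<subseteq> \<K>" unfolding N_def by (auto intro: inv_into_into)
    fix K assume K: "K \<in> \<K>"
    let ?K' = "inv_into \<K> code (code K)"
    have K': "?K' \<in> \<K>" "code ?K' = code K"
      using K by (auto intro: inv_into_into f_inv_into_f)
    have dims: "dim_row K = r" "dim_col K = l" "dim_row ?K' = r" "dim_col ?K' = l"
      using \<K> K K'(1) by auto
    have "((K - ?K') $$ (i, j))\<^sup>2 \<le> (2 * \<delta>)\<^sup>2" if ij: "i < r" "j < l" for i j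
    proof -
      have "trunc_int (K $$ (i, j) / \<delta>) = trunc_int (?K' $$ (i, j) / \<delta>)"
        using fun_cong[OF K'(2), of "(i, j)"] ij by (simp add: code_def)
      then have "\<bar>K $$ (i, j) / \<delta> - ?K' $$ (i, j) / \<delta>\<bar> \<le> 2" by (rule trunc_int_eq_imp_close)
      then have "\<bar>K $$ (i, j) - ?K' $$ (i, j)\<bar> \<le> 2 * \<delta>"
        using \<delta> by (simp add: field_simps flip: diff_divide_distrib)
      then have "\<bar>K $$ (i, j) - ?K' $$ (i, j)\<bar>\<^sup>2 \<le> (2 * \<delta>)\<^sup>2" by (intro power_mono) auto
      then show ?thesis using ij dims by simp
    qed
    then have "(\<Sum>i<r. \<Sum>j<l. ((K - ?K') $$ (i, j))\<^sup>2) \<le> (\<Sum>i<r. \<Sum>j<l. (2 * \<delta>)\<^sup>2)"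
      by (intro sum_mono) auto
    also have "\<dots> = n * (2 * \<delta>)\<^sup>2" by (simp add: n_def)
    also have "\<dots> = \<epsilon>\<^sup>2" using n by (simp add: \<delta>_def power_divide)
    finally have "sqrt (\<Sum>i<r. \<Sum>j<l. ((K - ?K') $$ (i, j))\<^sup>2) \<le> sqrt (\<epsilon>\<^sup>2)"
      by (rule real_sqrt_le_mono)
    then have "op_norm (K - ?K') \<le> \<epsilon>"
      using op_norm_le_entries[of "K - ?K'"] dims pos by simp
    moreover have "?K' \<in> N" unfolding N_def using K by auto
    ultimately show "\<exists>K'\<in>N. op_norm (K - K') \<le> \<epsilon>" by blast
  qed
  ultimately show ?thesis using count(2) by (intro exI[of _ N]) auto
qed

subsection \<open>Regret of the tracking algorithm\<close>

text \<open>Finiteness is essential: \<open>enn2real\<close> sends infinity to 0.\<close>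

lemma partial_sum_le_enn2real:
  assumes "(\<Sum>r. ennreal (f r)) < \<infinity>" "\<And>r. 0 \<le> f r"
  shows "(\<Sum>r<m. f r) \<le> enn2real (\<Sum>r. ennreal (f r))"
proof -
  have s: "summable f"
    by (rule summable_suminf_not_top) (use assms in \<open>auto simp: less_top\<close>)
  then have "enn2real (\<Sum>r. ennreal (f r)) = suminf f"
    using assms(2) by (simp add: suminf_ennreal2 suminf_nonneg)
  then show ?thesis using sum_le_suminf[OF s, of "{..<m}"] assms(2) by simp
qed

text \<open>Young's inequality for a causal convolution. After exchanging the sums, each input
  \<open>v s\<close> is charged with all its later echoes, whose coefficients total at most
  \<open>\<Lambda>\<close>.\<close>

lemma sum_convolution_le:
  fixes a v :: "nat \<Rightarrow> real"
  assumes part: "\<And>m. (\<Sum>r<m. a r) \<le> \<Lambda>" and v: "\<And>s. 0 \<le> v s"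
  shows "(\<Sum>t\<in>{1..T}. \<Sum>s\<in>{1..<t}. a (t - 1 - s) * v s) \<le> \<Lambda> * (\<Sum>s\<in>{1..T}. v s)"
proof -
  have "(\<Sum>t\<in>{1..T}. \<Sum>s\<in>{1..<t}. a (t - 1 - s) * v s)
      = (\<Sum>t\<in>{1..T}. \<Sum>s\<in>{1..T}. if s < t then a (t - 1 - s) * v s else 0)"
    by (intro sum.cong refl sum.mono_neutral_cong_left) auto
  also have "\<dots> = (\<Sum>s\<in>{1..T}. \<Sum>t\<in>{1..T}. if s < t then a (t - 1 - s) * v s else 0)"
    by (rule sum.swap)
  also have "\<dots> \<le> (\<Sum>s\<in>{1..T}. \<Lambda> * v s)"
  proof (rule sum_mono)
    fix s assume s: "s \<in> {1..T}"
    have "(\<Sum>t\<in>{1..T}. if s < t then a (t - 1 - s) * v s else 0) = (\<Sum>t\<in>{s<..T}. a (t - 1 - s) * v s)"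
      by (intro sum.mono_neutral_cong_right) (use s in auto)
    also have "\<dots> = (\<Sum>r<T - s. a r * v s)"
      by (rule sum.reindex_bij_witness[of _ "\<lambda>r. r + 1 + s" "\<lambda>t. t - 1 - s"]) (use s in auto)
    also have "\<dots> = (\<Sum>r<T - s. a r) * v s" by (simp add: sum_distrib_right)
    also have "\<dots> \<le> \<Lambda> * v s" by (intro mult_right_mono part v)
    finally show "(\<Sum>t\<in>{1..T}. if s < t then a (t - 1 - s) * v s else 0) \<le> \<Lambda> * v s" .
  qed
  finally show ?thesis by (simp add: sum_distrib_left)
qed

lemma vec_first_append: "vec_first (v @\<^sub>v u) (dim_vec v) = v"
  and vec_last_append: "vec_last (v @\<^sub>v u) (dim_vec u) = u"
  by (auto simp: vec_first_def vec_last_def intro!: eq_vecI)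

context benchmark
begin

lemma tracking_regret:
  fixes G \<mu> \<Lambda> \<eta> :: real and T :: nat and c :: "nat \<Rightarrow> real vec \<Rightarrow> real" and w :: "nat \<Rightarrow> real vec"
  defines "D \<equiv> (sqrt (1 + \<kappa>\<^sup>2) + 2 * \<Lambda>) * X"
  defines "L \<equiv> G * D"
  defines "Asc \<equiv> L\<^sup>2 / \<mu> * (1 + \<Lambda> * B_plus A B)"
  defines "\<eta> \<equiv> 1 / (16 * Asc)"
  assumes K0: "K0 \<in> carrier_mat du dx"
    and \<Lambda>: "\<And>m. (\<Sum>r<m. op_norm ((1\<^sub>m dx @\<^sub>r (- K0)) * (A - B * K0) ^\<^sub>m r)) \<le> \<Lambda>"
    and N: "finite N" "N \<noteq> {}" "N \<subseteq> \<K>" and K: "K \<in> N"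
    and G: "0 < G" and \<mu>: "0 < \<mu>"
    and reg: "\<And>t. t \<in> {1..T} \<Longrightarrow> regular_cost (dx + du) G D (c t)"
    and sc: "\<And>t. t \<in> {1..T} \<Longrightarrow> strongly_convex_on (dx + du) \<mu> (vball (dx + du) D) (c t)"
    and w: "\<And>t. t \<in> {1..T} \<Longrightarrow> w t \<in> vball dx W"
  shows "(\<Sum>t\<in>{1..T}. c t (joint A B (tracking_law A B K0 N \<eta> c w) w t))
    \<le> (\<Sum>t\<in>{1..T}. c t (joint A B (linear_law K) w t)) + 16 * Asc * ln (real (card N))"
proof -
  let ?n = "dx + du" and ?\<pi> = "tracking_law A B K0 N \<eta> c w"
  define x where "x t K = rollout A B (linear_law K) w t" for t K
  define u where "u t K = - (K *\<^sub>v x t K)" for t K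
  define y where "y t K = joint A B (linear_law K) w t" for t K
  define f where "f t K = c t (y t K)" for t K
  define p where "p = hedge N \<eta> f"
  define m where "m t = wmean ?n N (p t) (y t)" for t
  define xb where "xb t = wmean dx N (p t) (x t)" for t
  define ub where "ub t = wmean du N (p t) (u t)" for t
  define V where "V t = (\<Sum>K\<in>N. p t K * (vnorm (y t K - m t))\<^sup>2)" for t
  define v where "v s = A *\<^sub>v xb s + B *\<^sub>v ub s + w s - xb (Suc s)" for s
  define a where "a r = op_norm ((1\<^sub>m dx @\<^sub>r (- K0)) * (A - B * K0) ^\<^sub>m r)" for r
  have \<Lambda>0: "0 \<le> \<Lambda>" using \<Lambda>[of 0] by simp
  have Bp: "0 \<le> B_plus A B" by (simp add: B_plus_def)
  have s1: "0 \<le> sqrt (1 + \<kappa>\<^sup>2)" "0 < sqrt (1 + \<kappa>\<^sup>2)" by (auto simp: add_pos_nonneg)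
  have D0: "0 < D" unfolding D_def using X_pos s1 \<Lambda>0 by (intro mult_pos_pos add_pos_nonneg) auto
  have L0: "0 < L" using G D0 by (simp add: L_def)
  have BL: "0 < 1 + \<Lambda> * B_plus A B" using \<Lambda>0 Bp by (intro add_pos_nonneg) auto
  have Asc0: "0 < Asc" unfolding Asc_def using L0 \<mu> BL by simp
  have \<eta>0: "0 < \<eta>" using Asc0 by (simp add: \<eta>_def)
  \<comment> \<open>This identity fixes \<open>\<eta>\<close>. The part without
    \<open>B_plus\<close> feeds \<open>exp_weights_round\<close> through \<open>\<eta>\<mu>\<close>;
    the part with it bounds the tracking cost at the end.\<close>
  have \<eta>L: "16 * \<eta> * L\<^sup>2 * (1 + \<Lambda> * B_plus A B) = \<mu>"
    unfolding \<eta>_def Asc_def using L0 \<mu> BL by simp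
  have "16 * \<eta> * L\<^sup>2 * 1 \<le> 16 * \<eta> * L\<^sup>2 * (1 + \<Lambda> * B_plus A B)"
    using \<eta>0 \<Lambda>0 Bp by (intro mult_left_mono) auto
  then have \<eta>\<mu>: "16 * \<eta> * L\<^sup>2 \<le> \<mu>" unfolding \<eta>L by simp
  note Kc = policy_classD[OF _ A B]
  have NK: "K \<in> \<K>" if "K \<in> N" for K using N that by auto
  have wb: "w s \<in> vball dx W" if "s \<in> {1..<t}" "t \<in> {1..T}" for s t using w that by auto
  have xX: "x t K \<in> vball dx X" if "t \<in> {1..T}" "K \<in> N" for t K
    unfolding x_def using that by (intro state_bound NK wb) auto
  have xc: "x t K \<in> carrier_vec dx" if "t \<in> {1..T}" "K \<in> N" for t K
    using xX[OF that] by (simp add: vball_def)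
  have uc: "u t K \<in> carrier_vec du" if "K \<in> N" for t K
    unfolding u_def using Kc(1)[OF NK[OF that]] by (intro carrier_vecI) auto
  have yxu: "y t K = x t K @\<^sub>v u t K" for t K by (simp add: y_def x_def u_def linear_joint_eq)
  have yX: "y t K \<in> vball ?n (sqrt (1 + \<kappa>\<^sup>2) * X)" if "t \<in> {1..T}" "K \<in> N" for t K
    unfolding y_def using that by (intro joint_bound NK wb) auto
  have ballD: "z \<in> vball ?n D" if "z \<in> vball ?n (sqrt (1 + \<kappa>\<^sup>2) * X)" for z
  proof -
    have "sqrt (1 + \<kappa>\<^sup>2) * X \<le> D" unfolding D_def using X_pos \<Lambda>0 by (intro mult_right_mono) auto
    then show ?thesis using that by (auto simp: vball_def)
  qed
  have p0: "0 \<le> p t K" for t K unfolding p_def by (rule hedge_nonneg[OF N(1,2)])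
  have p1: "sum (p t) N = 1" for t unfolding p_def by (rule sum_hedge[OF N(1,2)])
  have V0: "0 \<le> V t" for t unfolding V_def using p0 by (intro sum_nonneg) auto
  have mX: "m t \<in> vball ?n (sqrt (1 + \<kappa>\<^sup>2) * X)" if "t \<in> {1..T}" for t
    unfolding m_def using yX[OF that] p0 p1 by (intro vnorm_convex_wmean_le) auto
  have mxu: "m t = xb t @\<^sub>v ub t" if "t \<in> {1..T}" for t
    unfolding m_def xb_def ub_def yxu by (rule wmean_append) (use xc[OF that] uc in auto)
  have ew: "ew_mean A B N \<eta> c w t = m t" for t
    using A B by (simp add: ew_mean_def m_def wmean_def p_def hedge_def ew_weight_def f_def y_def)
  have law: "?\<pi> t z = ub t - K0 *\<^sub>v (z - xb t)" if "t \<in> {1..T}" for t z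
    using vec_first_append[of "xb t" "ub t"] vec_last_append[of "xb t" "ub t"] A B
    by (simp add: tracking_law_def ew mxu[OF that] xb_def ub_def Let_def)
  have lip: "c t z - c t z' \<le> L * vnorm (z - z')"
    if "t \<in> {1..T}" "z \<in> vball ?n D" "z' \<in> vball ?n D" for t z z'
    using regular_cost_lipschitz[OF reg[OF that(1)] that(2,3)] by (simp add: L_def)

  have round: "(\<Sum>K\<in>N. p t K * exp (- \<eta> * f t K)) \<le> exp (- \<eta> * (c t (m t) + \<mu> / 4 * V t))"
    "vnorm (wmean ?n N (\<lambda>K. p t K - p (Suc t) K) (y t)) \<le> 4 * \<eta> * L * V t"
    if t: "t \<in> {1..T}" for t
  proof -
    let ?S = "\<Sum>K\<in>N. p t K * exp (- \<eta> * c t (y t K))"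
    obtain g where g: "g \<in> subdiff ?n (c t) (m t)" "vnorm g \<le> G * D"
      using regular_cost_subgradient[OF reg[OF t] ballD[OF mX[OF t]]] by blast
    have str: "c t (m t) + g \<bullet> (z - m t) + \<mu> / 2 * (vnorm (z - m t))\<^sup>2 \<le> c t z" if "z \<in> vball ?n D" for z
      using sc[OF t] ballD[OF mX[OF t]] that g unfolding strongly_convex_on_def by blast
    have gc: "g \<in> carrier_vec ?n" "vnorm g \<le> L" using g by (auto simp: subdiff_def L_def)
    have yD: "\<And>k. k \<in> N \<Longrightarrow> y t k \<in> vball ?n D" using ballD yX[OF t] by blast
    have 1: "?S \<le> exp (- \<eta> * (c t (m t) + \<mu> / 4 * V t))"
      by (rule exp_weights_round(1)[where c = "c t" and p = "p t" and Y = "y t" and N = N and D = D,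
            OF p0 p1 yD lip[OF t] gc str L0 \<mu> \<eta>0 \<eta>\<mu> m_def V_def refl])
    have 2: "vnorm (wmean ?n N (\<lambda>k. p t k - p t k * exp (- \<eta> * c t (y t k)) / ?S) (y t)) \<le> 4 * \<eta> * L * V t"
      by (rule exp_weights_round(2)[where c = "c t" and p = "p t" and Y = "y t" and N = N and D = D,
            OF p0 p1 yD lip[OF t] gc str L0 \<mu> \<eta>0 \<eta>\<mu> m_def V_def refl])
    show "(\<Sum>K\<in>N. p t K * exp (- \<eta> * f t K)) \<le> exp (- \<eta> * (c t (m t) + \<mu> / 4 * V t))"
      using 1 by (simp add: f_def)
    have "p (Suc t) K = p t K * exp (- \<eta> * c t (y t K)) / ?S" for K
      using hedge_Suc[OF N(1,2), of t \<eta> f K] t by (simp add: p_def f_def)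
    then show "vnorm (wmean ?n N (\<lambda>K. p t K - p (Suc t) K) (y t)) \<le> 4 * \<eta> * L * V t"
      using 2 by (simp only:)
  qed

  \<comment> \<open>The first bound confines the played trajectory, the second enters the regret.
    The residual of round \<open>s\<close> involves \<open>Suc s\<close>, which must still be a
    round; hence \<open>s < T\<close>.\<close>
  have drift: "vnorm (v s) \<le> 2 * X" "vnorm (v s) \<le> B_plus A B * (4 * \<eta> * L * V s)" "v s \<in> carrier_vec dx"
    if s: "s \<in> {1..<T}" for s
  proof -
    have s': "s \<in> {1..T}" "Suc s \<in> {1..T}" "1 \<le> s" using s by auto
    have ws: "w s \<in> carrier_vec dx" using w[OF s'(1)] by (simp add: vball_def)
    have xS: "x (Suc s) K = A *\<^sub>v x s K + B *\<^sub>v u s K + w s" for K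
      unfolding x_def u_def rollout_Suc[OF s'(3)] by (simp add: linear_law_def)
    \<comment> \<open>Needed for general weights: with \<open>p s\<close> the disturbance survives
      with mass 1 and the residual becomes a difference of two means of the same states; with the
      weight change its mass is 0 and it drops out.\<close>
    have lin: "wmean dx N q (x (Suc s))
        = A *\<^sub>v wmean dx N q (x s) + B *\<^sub>v wmean du N q (u s) + sum q N \<cdot>\<^sub>v w s" for q
    proof -
      have "wmean dx N q (x (Suc s)) = wmean dx N q (\<lambda>K. (A *\<^sub>v x s K + B *\<^sub>v u s K) + w s)"
        by (rule wmean_cong) (simp_all add: xS)
      also have "\<dots> = wmean dx N q (\<lambda>K. A *\<^sub>v x s K + B *\<^sub>v u s K) + wmean dx N q (\<lambda>_. w s)"
        by (rule wmean_add) (rule ws)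
      also have "wmean dx N q (\<lambda>K. A *\<^sub>v x s K + B *\<^sub>v u s K)
          = wmean dx N q (\<lambda>K. A *\<^sub>v x s K) + wmean dx N q (\<lambda>K. B *\<^sub>v u s K)"
        by (rule wmean_add) (use B in \<open>auto intro: carrier_vecI\<close>)
      also have "wmean dx N q (\<lambda>K. A *\<^sub>v x s K) = A *\<^sub>v wmean dx N q (x s)"
        by (rule mult_mat_wmean[OF A, symmetric]) (rule xc[OF s'(1)])
      also have "wmean dx N q (\<lambda>K. B *\<^sub>v u s K) = B *\<^sub>v wmean du N q (u s)"
        by (rule mult_mat_wmean[OF B, symmetric]) (rule uc)
      also have "wmean dx N q (\<lambda>_. w s) = sum q N \<cdot>\<^sub>v w s" by (rule wmean_const[OF ws])
      finally show ?thesis .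
    qed
    have v_eq: "v s = wmean dx N (p s) (x (Suc s)) - wmean dx N (p (Suc s)) (x (Suc s))"
      unfolding v_def lin[of "p s"] p1 xb_def ub_def by simp
    then show "v s \<in> carrier_vec dx" by simp
    have b: "wmean dx N (p r) (x (Suc s)) \<in> vball dx X" for r
      using xX[OF s'(2)] p0 p1 by (intro vnorm_convex_wmean_le) auto
    have "vnorm (v s) \<le> vnorm (wmean dx N (p s) (x (Suc s))) + vnorm (wmean dx N (p (Suc s)) (x (Suc s)))"
      unfolding v_eq by (rule vnorm_triangle_minus) simp
    then show "vnorm (v s) \<le> 2 * X" using b[of s] b[of "Suc s"] by (simp add: vball_def)
    let ?q = "\<lambda>K. p s K - p (Suc s) K"
    have "v s = wmean dx N ?q (x (Suc s))"
      unfolding v_eq by (rule wmean_diff_weights[symmetric])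
    also have "\<dots> = A *\<^sub>v wmean dx N ?q (x s) + B *\<^sub>v wmean du N ?q (u s) + sum ?q N \<cdot>\<^sub>v w s"
      by (rule lin)
    also have "sum ?q N = 0" using p1 by (simp add: sum_subtractf)
    also have "A *\<^sub>v wmean dx N ?q (x s) + B *\<^sub>v wmean du N ?q (u s) + 0 \<cdot>\<^sub>v w s
        = A *\<^sub>v wmean dx N ?q (x s) + B *\<^sub>v wmean du N ?q (u s)"
      using A B carrier_vecD[OF ws] by (intro eq_vecI) simp_all
    finally have "vnorm (v s) \<le> B_plus A B * vnorm (wmean dx N ?q (x s) @\<^sub>v wmean du N ?q (u s))"
      using B_plus_bound[OF A B, of "wmean dx N ?q (x s)" "wmean du N ?q (u s)"] by simp
    also have "wmean dx N ?q (x s) @\<^sub>v wmean du N ?q (u s) = wmean ?n N ?q (y s)"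
      unfolding yxu by (rule wmean_append[symmetric]) (use xc[OF s'(1)] uc in auto)
    also have "B_plus A B * vnorm (wmean ?n N ?q (y s)) \<le> B_plus A B * (4 * \<eta> * L * V s)"
      by (rule mult_left_mono[OF round(2)[OF s'(1)] Bp])
    finally show "vnorm (v s) \<le> B_plus A B * (4 * \<eta> * L * V s)" .
  qed

  have track: "joint A B ?\<pi> w t \<in> carrier_vec ?n"
    "vnorm (joint A B ?\<pi> w t - m t) \<le> (\<Sum>s\<in>{1..<t}. a (t - 1 - s) * vnorm (v s))"
    if t: "t \<in> {1..T}" for t
  proof -
    have x1: "xb 1 = 0\<^sub>v dx"
      unfolding xb_def using A by (intro eq_vecI) (simp_all add: x_def)
    have "joint A B ?\<pi> w t \<in> carrier_vec ?n \<and>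
      vnorm (joint A B ?\<pi> w t - (xb t @\<^sub>v ub t)) \<le> (\<Sum>s\<in>{1..<t}. a (t - 1 - s) * vnorm (v s))"
      unfolding a_def v_def
      by (intro conjI tracking_error_bound[where xb = xb and ub = ub, OF A B K0]; use law t x1 w in \<open>auto simp: xb_def ub_def vball_def\<close>)
    then show "joint A B ?\<pi> w t \<in> carrier_vec ?n"
      "vnorm (joint A B ?\<pi> w t - m t) \<le> (\<Sum>s\<in>{1..<t}. a (t - 1 - s) * vnorm (v s))"
      unfolding mxu[OF t] by blast+
  qed
  have a0: "0 \<le> a r" for r by (simp add: a_def)
  \<comment> \<open>Only now may the Lipschitz bound be applied to the played point. The mean
    contributes \<open>sqrt (1 + \<kappa>\<^sup>2) * X\<close> and the tracking error
    \<open>2 * \<Lambda> * X\<close>, exactly the two summands of \<open>D\<close>.\<close>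
  have yD: "joint A B ?\<pi> w t \<in> vball ?n D" if t: "t \<in> {1..T}" for t
  proof -
    have "(\<Sum>s\<in>{1..<t}. a (t - 1 - s) * vnorm (v s)) \<le> (\<Sum>s\<in>{1..<t}. a (t - 1 - s) * (2 * X))"
      using t a0 by (intro sum_mono mult_left_mono drift(1)) auto
    also have "\<dots> = (\<Sum>s\<in>{1..<t}. a (t - 1 - s)) * (2 * X)" by (rule sum_distrib_right[symmetric])
    also have "\<dots> \<le> \<Lambda> * (2 * X)"
      unfolding sum_convolution_index[of a] using \<Lambda> X_pos by (intro mult_right_mono) (auto simp: a_def)
    finally have d: "vnorm (joint A B ?\<pi> w t - m t) \<le> \<Lambda> * (2 * X)" using track(2)[OF t] by linarith
    let ?z = "joint A B ?\<pi> w t"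
    have dims: "dim_vec ?z = ?n" "dim_vec (m t) = ?n" using track(1)[OF t] by (auto simp: m_def)
    have "?z = (?z - m t) + m t" using dims by (intro eq_vecI) auto
    then have "vnorm ?z \<le> vnorm (?z - m t) + vnorm (m t)"
      using vnorm_triangle[of "?z - m t" "m t"] dims by simp
    also have "\<dots> \<le> \<Lambda> * (2 * X) + sqrt (1 + \<kappa>\<^sup>2) * X"
      using d mX[OF t] by (intro add_mono) (auto simp: vball_def)
    also have "\<dots> = D" by (simp add: D_def algebra_simps)
    finally show ?thesis using track(1)[OF t] by (simp add: vball_def)
  qed
  have "(\<Sum>t\<in>{1..T}. c t (joint A B ?\<pi> w t) - c t (m t))
      \<le> (\<Sum>t\<in>{1..T}. L * (\<Sum>s\<in>{1..<t}. a (t - 1 - s) * (B_plus A B * (4 * \<eta> * L * V s))))"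
  proof (rule sum_mono)
    fix t assume t: "t \<in> {1..T}"
    have "c t (joint A B ?\<pi> w t) - c t (m t) \<le> L * vnorm (joint A B ?\<pi> w t - m t)"
      by (rule lip[OF t yD[OF t] ballD[OF mX[OF t]]])
    also have "\<dots> \<le> L * (\<Sum>s\<in>{1..<t}. a (t - 1 - s) * vnorm (v s))"
      using L0 track(2)[OF t] by (intro mult_left_mono) auto
    also have "\<dots> \<le> L * (\<Sum>s\<in>{1..<t}. a (t - 1 - s) * (B_plus A B * (4 * \<eta> * L * V s)))"
      using L0 a0 t by (intro mult_left_mono sum_mono drift(2)) auto
    finally show "c t (joint A B ?\<pi> w t) - c t (m t)
      \<le> L * (\<Sum>s\<in>{1..<t}. a (t - 1 - s) * (B_plus A B * (4 * \<eta> * L * V s)))" .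
  qed
  also have "\<dots> = L * (\<Sum>t\<in>{1..T}. \<Sum>s\<in>{1..<t}. a (t - 1 - s) * (B_plus A B * (4 * \<eta> * L * V s)))"
    by (rule sum_distrib_left[symmetric])
  also have "\<dots> \<le> L * (\<Lambda> * (\<Sum>s\<in>{1..T}. B_plus A B * (4 * \<eta> * L * V s)))"
    using L0 Bp \<eta>0 V0 \<Lambda> by (intro mult_left_mono sum_convolution_le) (auto simp: a_def)
  also have "\<dots> = (4 * \<eta> * L\<^sup>2 * (\<Lambda> * B_plus A B)) * (\<Sum>s\<in>{1..T}. V s)"
  proof -
    have "(\<Sum>s\<in>{1..T}. B_plus A B * (4 * \<eta> * L * V s)) = (B_plus A B * (4 * \<eta> * L)) * (\<Sum>s\<in>{1..T}. V s)"
      unfolding sum_distrib_left by (simp add: mult_ac)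
    then show ?thesis by (simp add: power2_eq_square mult_ac)
  qed
  also have "\<dots> \<le> \<mu> / 4 * (\<Sum>s\<in>{1..T}. V s)"
  proof (rule mult_right_mono)
    have "0 \<le> \<eta> * L\<^sup>2" using \<eta>0 by simp
    then show "4 * \<eta> * L\<^sup>2 * (\<Lambda> * B_plus A B) \<le> \<mu> / 4"
      using \<eta>L by (simp add: distrib_left)
  qed (use V0 in \<open>simp add: sum_nonneg\<close>)
  finally have tr: "(\<Sum>t\<in>{1..T}. c t (joint A B ?\<pi> w t))
      \<le> (\<Sum>t\<in>{1..T}. c t (m t)) + \<mu> / 4 * (\<Sum>s\<in>{1..T}. V s)"
    by (simp add: sum_subtractf)
  \<comment> \<open>The slack is part of the comparison loss, so the same sum of variances stands on
    the right of \<open>tr\<close> and on the left here, and cancels.\<close>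
  have "(\<Sum>t\<in>{1..T}. c t (m t) + \<mu> / 4 * V t) \<le> (\<Sum>t\<in>{1..T}. f t K) + ln (real (card N)) / \<eta>"
    by (rule hedge_regret[OF N(1,2) \<eta>0 K]) (use round(1) in \<open>simp add: p_def\<close>)
  then have "(\<Sum>t\<in>{1..T}. c t (m t)) + \<mu> / 4 * (\<Sum>s\<in>{1..T}. V s)
      \<le> (\<Sum>t\<in>{1..T}. c t (y t K)) + ln (real (card N)) / \<eta>"
    by (simp add: sum.distrib f_def sum_distrib_left)
  with tr show ?thesis by (simp add: y_def \<eta>_def mult_ac)
qed

end

text \<open>The number 4 in the final logarithm serves twice: its square absorbs the factor 6 of the
  covering number, and, exceeding \<open>exp 1\<close>, it makes the logarithm at least 1, so that
  an additive constant can be absorbed.\<close>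

lemma ln_cover_size_le:
  fixes x :: real
  assumes "0 \<le> x"
  shows "ln (6 * (1 + x)) \<le> 2 * ln (4 + x)" and "1 \<le> ln (4 + x)"
proof -
  have "6 * (1 + x) \<le> (4 + x)\<^sup>2" using assms by (simp add: power2_eq_square algebra_simps)
  then have "ln (6 * (1 + x)) \<le> ln ((4 + x)\<^sup>2)" using assms by (intro ln_mono) auto
  also have "\<dots> = 2 * ln (4 + x)" using assms by (simp add: ln_realpow)
  finally show "ln (6 * (1 + x)) \<le> 2 * ln (4 + x)" .
  have "exp 1 \<le> 4 + x" using exp_le assms by linarith
  then show "1 \<le> ln (4 + x)" using assms by (simp add: ln_ge_iff)
qed

context benchmark
begin

text \<open>Replacing a policy by its neighbour in the cover costs at most
  \<open>L * LK * \<epsilon>\<close> in each round. Since the bound is uniform in the policy, it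
  passes to the infimum, attained or not.\<close>

lemma cover_tracking_regret:
  fixes G \<mu> \<Lambda> \<epsilon> :: real and T :: nat
  defines "D \<equiv> (sqrt (1 + \<kappa>\<^sup>2) + 2 * \<Lambda>) * X"
  defines "L \<equiv> G * D"
  defines "Asc \<equiv> L\<^sup>2 / \<mu> * (1 + \<Lambda> * B_plus A B)"
  defines "\<eta> \<equiv> 1 / (16 * Asc)"
  assumes K0: "K0 \<in> carrier_mat du dx"
    and \<Lambda>: "\<And>m. (\<Sum>r<m. op_norm ((1\<^sub>m dx @\<^sub>r (- K0)) * (A - B * K0) ^\<^sub>m r)) \<le> \<Lambda>"
    and ne: "\<K> \<noteq> {}" and cover: "finite_cover \<epsilon> N \<K>" and \<epsilon>: "0 < \<epsilon>"
    and G: "0 < G" and \<mu>: "0 < \<mu>"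
    and reg: "\<And>t. t \<in> {1..T} \<Longrightarrow> regular_cost (dx + du) G D (c t)"
    and sc: "\<And>t. t \<in> {1..T} \<Longrightarrow> strongly_convex_on (dx + du) \<mu> (vball (dx + du) D) (c t)"
    and w: "\<And>t. t \<in> {1..T} \<Longrightarrow> w t \<in> vball dx W"
  shows "regret A B \<K> (tracking_law A B K0 N \<eta> c w) c w T
    \<le> 16 * Asc * ln (real (card N)) + real T * L * LK * \<epsilon>"
proof -
  have N: "finite N" "N \<subseteq> \<K>" using cover by (auto simp: finite_cover_def)
  have Nne: "N \<noteq> {}" using cover ne unfolding finite_cover_def by blast
  have \<Lambda>0: "0 \<le> \<Lambda>" using \<Lambda>[of 0] by simp
  have D0: "0 \<le> D" unfolding D_def using X_pos \<Lambda>0 by (intro mult_nonneg_nonneg add_nonneg_nonneg) auto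
  have L0: "0 \<le> L" using G D0 by (simp add: L_def)
  let ?alg = "\<Sum>t\<in>{1..T}. c t (joint A B (tracking_law A B K0 N \<eta> c w) w t)"
  let ?b = "16 * Asc * ln (real (card N)) + real T * L * LK * \<epsilon>"
  have "?alg - ?b \<le> (INF K\<in>\<K>. \<Sum>t\<in>{1..T}. c t (joint A B (linear_law K) w t))"
  proof (rule cINF_greatest[OF ne])
    fix K assume K: "K \<in> \<K>"
    obtain K' where K': "K' \<in> N" "op_norm (K - K') \<le> \<epsilon>"
      using cover K unfolding finite_cover_def by blast
    have "c t (joint A B (linear_law K') w t) \<le> c t (joint A B (linear_law K) w t) + L * LK * \<epsilon>"
      if t: "t \<in> {1..T}" for t
    proof -
      let ?y = "joint A B (linear_law K) w t" and ?y' = "joint A B (linear_law K') w t"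
      have t1: "1 \<le> t" and ws: "\<And>s. s \<in> {1..<t} \<Longrightarrow> w s \<in> vball dx W" using t w by auto
      have K'\<K>: "K' \<in> \<K>" using K'(1) N by blast
      have "sqrt (1 + \<kappa>\<^sup>2) * X \<le> D" unfolding D_def using X_pos \<Lambda>0 by (intro mult_right_mono) auto
      then have y: "?y \<in> vball (dx + du) D" "?y' \<in> vball (dx + du) D"
        using joint_bound[where w = w, OF K t1 ws] joint_bound[where w = w, OF K'\<K> t1 ws] by (auto simp: vball_def)
      have "c t ?y' - c t ?y \<le> L * vnorm (?y' - ?y)"
        unfolding L_def by (rule regular_cost_lipschitz[OF reg[OF t] y(2,1)])
      also have "vnorm (?y' - ?y) = vnorm (?y - ?y')"
        using y by (intro vnorm_minus_commute) (auto simp: vball_def)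
      also have "L * vnorm (?y - ?y') \<le> L * (LK * op_norm (K - K'))"
        by (rule mult_left_mono[OF joint_lipschitz[where w = w, OF K K'\<K> t1 ws] L0])
      also have "\<dots> \<le> L * (LK * \<epsilon>)"
        using L0 LK_pos K'(2) by (intro mult_left_mono) auto
      finally show ?thesis by (simp add: mult_ac)
    qed
    then have "(\<Sum>t\<in>{1..T}. c t (joint A B (linear_law K') w t))
        \<le> (\<Sum>t\<in>{1..T}. c t (joint A B (linear_law K) w t) + L * LK * \<epsilon>)"
      by (rule sum_mono)
    also have "\<dots> = (\<Sum>t\<in>{1..T}. c t (joint A B (linear_law K) w t)) + real T * L * LK * \<epsilon>"
      by (simp add: sum.distrib)
    finally have "(\<Sum>t\<in>{1..T}. c t (joint A B (linear_law K') w t))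
        \<le> (\<Sum>t\<in>{1..T}. c t (joint A B (linear_law K) w t)) + real T * L * LK * \<epsilon>" .
    moreover have "?alg \<le> (\<Sum>t\<in>{1..T}. c t (joint A B (linear_law K') w t)) + 16 * Asc * ln (real (card N))"
      unfolding \<eta>_def Asc_def L_def D_def
      by (rule tracking_regret[OF K0 \<Lambda> N(1) Nne N(2) K'(1) G \<mu>]) (use reg sc w in \<open>simp_all add: D_def\<close>)
    ultimately show "?alg - ?b \<le> (\<Sum>t\<in>{1..T}. c t (joint A B (linear_law K) w t))" by linarith
  qed
  then show ?thesis unfolding regret_def by linarith
qed

end

subsection \<open>System constants\<close>

text \<open>On an eigenvector for an eigenvalue \<open>l\<close> of largest modulus,
  \<open>F\<close> to the power \<open>r\<close> acts as \<open>l ^ r\<close>. If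
  \<open>norm l\<close> were at least 1, a nonzero coordinate could not be bounded by a sequence
  tending to 0. Positive dimension ensures that an eigenvalue exists.\<close>

lemma schur_stable_if_powers_tendsto_0:
  assumes F: "F \<in> carrier_mat n n" and n: "0 < n"
    and lim: "(\<lambda>r. op_norm (F ^\<^sub>m r)) \<longlonglongrightarrow> 0"
  shows "schur_stable F"
proof -
  let ?F = "map_mat complex_of_real F"
  have Fc: "?F \<in> carrier_mat n n" using F by simp
  obtain l where l: "eigenvalue ?F l" and sr: "spectral_radius ?F = norm l"
    using spectral_radius_mem_max(1)[OF Fc n] by (auto simp: spectrum_def)
  obtain v where ev: "eigenvector ?F v l" using l by (auto simp: eigenvalue_def)
  then have v: "v \<in> carrier_vec n" "v \<noteq> 0\<^sub>v n" using F by (auto simp: eigenvector_def)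
  then obtain i where i: "i < n" "v $ i \<noteq> 0"
    by (metis carrier_vecD eq_vecI index_zero_vec(1) index_zero_vec(2))
  \<comment> \<open>\<open>op_norm\<close> is defined on real vectors; as \<open>F\<close> is real,
    it acts on the real and imaginary parts separately.\<close>
  let ?a = "map_vec Re v" and ?b = "map_vec Im v"
  have bound: "norm l ^ r * norm (v $ i) \<le> op_norm (F ^\<^sub>m r) * (vnorm ?a + vnorm ?b)" for r
  proof -
    let ?M = "F ^\<^sub>m r"
    have M: "?M \<in> carrier_mat n n" using F by simp
    have "?F ^\<^sub>m r = map_mat complex_of_real ?M"
      by (rule of_real_hom.mat_hom_pow[OF F, symmetric])
    then have "map_mat complex_of_real ?M *\<^sub>v v = l ^ r \<cdot>\<^sub>v v"
      using eigenvector_pow[OF Fc ev, of r] by simp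
    then have eq: "(map_mat complex_of_real ?M *\<^sub>v v) $ i = l ^ r * v $ i" using i v by simp
    have re: "Re ((map_mat complex_of_real ?M *\<^sub>v v) $ i) = (?M *\<^sub>v ?a) $ i"
      using i v carrier_matD[OF F] carrier_matD[OF M] by (simp add: scalar_prod_def)
    have im: "Im ((map_mat complex_of_real ?M *\<^sub>v v) $ i) = (?M *\<^sub>v ?b) $ i"
      using i v carrier_matD[OF F] carrier_matD[OF M] by (simp add: scalar_prod_def)
    have "norm l ^ r * norm (v $ i) = norm ((map_mat complex_of_real ?M *\<^sub>v v) $ i)"
      by (simp add: eq norm_mult norm_power)
    also have "\<dots> \<le> \<bar>(?M *\<^sub>v ?a) $ i\<bar> + \<bar>(?M *\<^sub>v ?b) $ i\<bar>"
      using cmod_le[of "(map_mat complex_of_real ?M *\<^sub>v v) $ i"] unfolding re im .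
    also have "\<dots> \<le> vnorm (?M *\<^sub>v ?a) + vnorm (?M *\<^sub>v ?b)"
      using M i by (intro add_mono abs_index_le_vnorm) auto
    also have "\<dots> \<le> op_norm ?M * vnorm ?a + op_norm ?M * vnorm ?b"
      using M v by (intro add_mono vnorm_mult_mat_vec_le) auto
    finally show ?thesis by (simp add: distrib_left)
  qed
  have "norm l < 1"
  proof (rule ccontr)
    assume "\<not> ?thesis"
    then have ge: "1 \<le> norm l ^ r" for r by simp
    have "norm (v $ i) \<le> op_norm (F ^\<^sub>m r) * (vnorm ?a + vnorm ?b)" for r
      using bound[of r] mult_right_mono[OF ge[of r], of "norm (v $ i)"] by simp
    moreover have "(\<lambda>r. op_norm (F ^\<^sub>m r) * (vnorm ?a + vnorm ?b)) \<longlonglongrightarrow> 0 * (vnorm ?a + vnorm ?b)"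
      by (intro tendsto_mult lim tendsto_const)
    ultimately have "norm (v $ i) \<le> 0 * (vnorm ?a + vnorm ?b)"
      by (intro LIMSEQ_le_const) auto
    then show False using i by simp
  qed
  then show ?thesis by (simp add: schur_stable_def sr)
qed

text \<open>Without finiteness \<open>enn2real\<close> would turn the complexity into 0 and the
  system constant would bound nothing. A gain with finite \<open>Lambda\<close> is itself admissible
  in the infimum: the identity block makes the summands dominate the powers of the closed loop,
  which therefore tend to 0, and \<open>Lambda_B\<close> is at most \<open>Lambda\<close> times
  \<open>op_norm B\<close>.\<close>

lemma track_complexity_finite:
  assumes A: "A \<in> carrier_mat dx dx" and B: "B \<in> carrier_mat dx du" and K: "K \<in> carrier_mat du dx"
    and dx: "1 \<le> dx" and fin: "Lambda A B K < \<infinity>"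
  shows "track_complexity A B < \<infinity>"
proof -
  let ?F = "A - B * K" and ?\<Phi> = "1\<^sub>m dx @\<^sub>r (- K)"
  have F: "?F \<in> carrier_mat dx dx" by (rule minus_carrier_mat[OF mult_carrier_mat[OF B K]])
  have \<Phi>: "?\<Phi> \<in> carrier_mat (dx + du) dx" using K by auto
  have Lam: "Lambda A B K = (\<Sum>r. ennreal (op_norm (?\<Phi> * ?F ^\<^sub>m r)))"
    using A by (simp add: Lambda_def)
  have le: "op_norm (?F ^\<^sub>m r) \<le> op_norm (?\<Phi> * ?F ^\<^sub>m r)" for r
  proof (rule op_norm_le)
    fix v :: "real vec" assume "v \<in> carrier_vec (dim_col (?F ^\<^sub>m r))"
    then have v: "v \<in> carrier_vec dx" by (simp only: carrier_matD(2)[OF pow_carrier_mat[OF F]])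
    have Fv: "?F ^\<^sub>m r *\<^sub>v v \<in> carrier_vec dx" by (rule mult_mat_vec_carrier[OF pow_carrier_mat[OF F] v])
    have "(?\<Phi> * ?F ^\<^sub>m r) *\<^sub>v v = ?\<Phi> *\<^sub>v (?F ^\<^sub>m r *\<^sub>v v)"
      by (rule assoc_mult_mat_vec[OF \<Phi> pow_carrier_mat[OF F] v])
    also have "\<dots> = (1\<^sub>m dx *\<^sub>v (?F ^\<^sub>m r *\<^sub>v v)) @\<^sub>v (- K *\<^sub>v (?F ^\<^sub>m r *\<^sub>v v))"
      by (rule mat_mult_append[OF one_carrier_mat _ Fv]) (use K in simp)
    finally have "vnorm (?F ^\<^sub>m r *\<^sub>v v) \<le> vnorm ((?\<Phi> * ?F ^\<^sub>m r) *\<^sub>v v)"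
      using vnorm_append_ge1 Fv by simp
    also have "\<dots> \<le> op_norm (?\<Phi> * ?F ^\<^sub>m r) * vnorm v"
      by (rule vnorm_mult_mat_vec_le) (use carrier_matD[OF pow_carrier_mat[OF F, of r]] v in simp)
    finally show "vnorm (?F ^\<^sub>m r *\<^sub>v v) \<le> op_norm (?\<Phi> * ?F ^\<^sub>m r) * vnorm v" .
  qed simp
  have "summable (\<lambda>r. op_norm (?\<Phi> * ?F ^\<^sub>m r))"
    by (rule summable_suminf_not_top) (use fin Lam in \<open>auto simp: less_top\<close>)
  then have "(\<lambda>r. op_norm (?F ^\<^sub>m r)) \<longlonglongrightarrow> 0"
    by (intro tendsto_sandwich[OF _ _ tendsto_const summable_LIMSEQ_zero]) (simp_all add: le)
  then have schur: "schur_stable ?F"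
    using schur_stable_if_powers_tendsto_0[OF F] dx by simp
  have "Lambda_B A B K \<le> (\<Sum>r. ennreal (op_norm (?\<Phi> * ?F ^\<^sub>m r)) * ennreal (op_norm B))"
    unfolding Lambda_B_def
  proof (rule suminf_le)
    fix r
    have "op_norm (?F ^\<^sub>m r * B) \<le> op_norm (?F ^\<^sub>m r) * op_norm B"
      by (rule op_norm_mult) (use carrier_matD[OF pow_carrier_mat[OF F, of r]] B in simp)
    also have "\<dots> \<le> op_norm (?\<Phi> * ?F ^\<^sub>m r) * op_norm B"
      by (rule mult_right_mono[OF le]) simp
    finally show "ennreal (op_norm (?F ^\<^sub>m r * B)) \<le> ennreal (op_norm (?\<Phi> * ?F ^\<^sub>m r)) * ennreal (op_norm B)"
      by (simp add: ennreal_leI flip: ennreal_mult)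
  qed simp_all
  also have "\<dots> = Lambda A B K * ennreal (op_norm B)" unfolding Lam by simp
  also have "\<dots> < \<infinity>" using fin by (simp add: ennreal_mult_less_top)
  finally have "Max {1, Lambda A B K, Lambda_B A B K} < \<infinity>" using fin by simp
  moreover have "track_complexity A B \<le> Max {1, Lambda A B K, Lambda_B A B K}"
    unfolding track_complexity_def by (rule INF_lower) (use A B K schur in simp)
  ultimately show ?thesis by (rule order.strict_trans1[rotated])
qed

text \<open>The norm of \<open>B\<close> is the term \<open>r = 0\<close> of the series. This lets
  the system constant depend on \<open>B\<close> only through the complexity.\<close>

lemma op_norm_input_le_Lambda_B:
  assumes A: "A \<in> carrier_mat dx dx" and B: "B \<in> carrier_mat dx du" and K: "K \<in> carrier_mat du dx"
  shows "ennreal (op_norm B) \<le> Lambda_B A B K"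
proof -
  have "ennreal (op_norm B) = (\<Sum>r\<in>{0}. ennreal (op_norm ((A - B * K) ^\<^sub>m r * B)))"
    using A B K by simp
  also have "\<dots> \<le> Lambda_B A B K" unfolding Lambda_B_def by (rule sum_le_suminf) auto
  finally show ?thesis .
qed

text \<open>Any policy \<open>K\<close> of the class gives \<open>A = (A - B K) + B K\<close>, and
  the class condition at \<open>r = 1\<close> bounds the first summand. So \<open>A\<close> too
  enters only through \<open>\<kappa>\<close> and \<open>op_norm B\<close>.\<close>

lemma op_norm_state_matrix_le:
  assumes A: "A \<in> carrier_mat dx dx" and B: "B \<in> carrier_mat dx du"
    and K: "K \<in> policy_class A B \<kappa> \<gamma>" and \<gamma>: "0 < \<gamma>" "\<gamma> < 1" and \<kappa>: "1 \<le> \<kappa>"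
  shows "op_norm A \<le> \<kappa>\<^sup>2 + op_norm B * \<kappa>"
proof -
  note Kc = policy_classD[OF K A B]
  have BK: "B * K \<in> carrier_mat dx dx" using B Kc(1) by simp
  have "A = (A - B * K) + B * K" using A BK by (intro eq_matI) auto
  then have "op_norm A \<le> op_norm (A - B * K) + op_norm (B * K)"
    using op_norm_add[OF Kc(4) BK] by simp
  also have "op_norm (A - B * K) \<le> \<kappa>\<^sup>2 * 1"
    using Kc(3)[of 1] Kc(4) \<gamma> mult_left_mono[of "1 - \<gamma>" 1 "\<kappa>\<^sup>2"] by simp
  also have "op_norm (B * K) \<le> op_norm B * op_norm K" by (rule op_norm_mult) (use B Kc(1) in simp)
  also have "op_norm B * op_norm K \<le> op_norm B * \<kappa>" using Kc(2) by (rule mult_left_mono) simp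
  finally show ?thesis by simp
qed

text \<open>
  Here \<open>q\<close> stands for the track complexity: \<open>\<Lambda>(K0)\<close> and \<open>op_norm B\<close> are at most \<open>2 q\<close>, so that
  \<open>D \<le> a W / \<gamma>\<close> and \<open>B\<^sub>+ \<le> \<kappa>\<^sup>2 + 2 q \<kappa> + 2 q\<close>.
\<close>

definition system_constant :: "nat \<Rightarrow> nat \<Rightarrow> real \<Rightarrow> ennreal \<Rightarrow> real" where
  "system_constant dx du \<kappa> \<CC> = (let q = enn2real \<CC>; a = (sqrt (1 + \<kappa>\<^sup>2) + 4 * q) * \<kappa>\<^sup>2 in
     1 + \<bar>33 * (a\<^sup>2 * (1 + 2 * q * (\<kappa>\<^sup>2 + 2 * q * \<kappa> + 2 * q)))\<bar>
       + \<bar>2 * (\<kappa> * sqrt (real (min dx du))) * (\<kappa>\<^sup>2 + (1 + \<kappa>) * \<kappa> ^ 4 * (2 * q))\<bar>)"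

text \<open>The absolute values and the leading 1 in the definition are there for this: positivity
  is claimed for all arguments, negative \<open>\<kappa>\<close> included.\<close>

lemma system_constant_pos: "0 < system_constant dx du \<kappa> \<CC>"
  unfolding system_constant_def Let_def by linarith

lemma system_constant_ge:
  assumes "q = enn2real \<CC>" "a = (sqrt (1 + \<kappa>\<^sup>2) + 4 * q) * \<kappa>\<^sup>2"
  shows "33 * (a\<^sup>2 * (1 + 2 * q * (\<kappa>\<^sup>2 + 2 * q * \<kappa> + 2 * q))) \<le> system_constant dx du \<kappa> \<CC>"
    and "2 * (\<kappa> * sqrt (real (min dx du))) * (\<kappa>\<^sup>2 + (1 + \<kappa>) * \<kappa> ^ 4 * (2 * q)) \<le> system_constant dx du \<kappa> \<CC>"
  unfolding system_constant_def Let_def assms by linarith+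

text \<open>Pure arithmetic on the norms. For the argument of the logarithm \<open>L\<close> is
  needed from below, since \<open>Asc\<close> contains its square in a denominator; there
  \<open>W\<close> cancels and one power of \<open>\<gamma>\<close> remains.\<close>

lemma system_bound:
  fixes \<kappa> \<gamma> W G \<mu> q L0 Bp b R dK T :: real
  assumes \<kappa>: "1 \<le> \<kappa>" and \<gamma>: "0 < \<gamma>" and pos: "0 < W" "0 < G" "0 < \<mu>" "0 < dK" "0 \<le> T" "0 \<le> R"
    and L0: "0 \<le> L0" "L0 \<le> 2 * q" and b: "0 \<le> b" "b \<le> 2 * q"
    and Bp: "0 \<le> Bp" "Bp \<le> \<kappa>\<^sup>2 + b * \<kappa> + b"
  defines "L \<equiv> G * ((sqrt (1 + \<kappa>\<^sup>2) + 2 * L0) * (\<kappa>\<^sup>2 * W / \<gamma>))"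
  defines "Asc \<equiv> L\<^sup>2 / \<mu> * (1 + L0 * Bp)"
  defines "LK \<equiv> \<kappa>\<^sup>2 * W / \<gamma> + (1 + \<kappa>) * \<kappa> ^ 4 * b * W / \<gamma>\<^sup>2"
  assumes \<gamma>1: "\<gamma> < 1"
  shows "Asc \<le> ((sqrt (1 + \<kappa>\<^sup>2) + 4 * q) * \<kappa>\<^sup>2)\<^sup>2 * (1 + 2 * q * (\<kappa>\<^sup>2 + 2 * q * \<kappa> + 2 * q)) * (G\<^sup>2 * W\<^sup>2 / (\<mu> * \<gamma>\<^sup>2))"
    and "2 * R * T * L * LK / (Asc * dK)
      \<le> 2 * R * (\<kappa>\<^sup>2 + (1 + \<kappa>) * \<kappa> ^ 4 * (2 * q)) * \<mu> * T / (G * dK * \<gamma>)"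
proof -
  let ?s = "sqrt (1 + \<kappa>\<^sup>2)"
  have s: "1 \<le> ?s" by simp
  have q: "0 \<le> q" using L0 by simp
  have k2: "1 \<le> \<kappa>\<^sup>2" using \<kappa> by simp
  have L_eq: "L = ((?s + 2 * L0) * \<kappa>\<^sup>2) * (G * W / \<gamma>)" by (simp add: L_def)
  have GW: "0 < G * W / \<gamma>" using pos \<gamma> by simp
  have Bp': "Bp \<le> \<kappa>\<^sup>2 + 2 * q * \<kappa> + 2 * q"
    using Bp(2) b mult_right_mono[OF b(2), of \<kappa>] \<kappa> by linarith
  have "L \<le> ((?s + 4 * q) * \<kappa>\<^sup>2) * (G * W / \<gamma>)"
    unfolding L_eq using L0 s GW by (intro mult_right_mono) auto
  \<comment> \<open>Both \<open>sqrt (1 + \<kappa>\<^sup>2)\<close> and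
    \<open>\<kappa>\<^sup>2\<close> are at least 1.\<close>
  moreover have Lge: "G * W / \<gamma> \<le> L"
  proof -
    have "1 * 1 \<le> (?s + 2 * L0) * \<kappa>\<^sup>2" by (intro mult_mono) (use s L0 k2 in linarith)+
    then show ?thesis unfolding L_eq using GW mult_right_mono[of 1 "(?s + 2 * L0) * \<kappa>\<^sup>2" "G * W / \<gamma>"] by simp
  qed
  ultimately have "L\<^sup>2 \<le> (((?s + 4 * q) * \<kappa>\<^sup>2) * (G * W / \<gamma>))\<^sup>2"
    using GW by (intro power_mono) auto
  moreover have "1 + L0 * Bp \<le> 1 + 2 * q * (\<kappa>\<^sup>2 + 2 * q * \<kappa> + 2 * q)"
    using L0 Bp Bp' q by (intro add_left_mono mult_mono) auto
  ultimately have "L\<^sup>2 / \<mu> * (1 + L0 * Bp)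
      \<le> (((?s + 4 * q) * \<kappa>\<^sup>2) * (G * W / \<gamma>))\<^sup>2 / \<mu> * (1 + 2 * q * (\<kappa>\<^sup>2 + 2 * q * \<kappa> + 2 * q))"
    using pos L0 Bp q by (intro mult_mono divide_right_mono) (auto intro!: add_nonneg_nonneg)
  then show "Asc \<le> ((?s + 4 * q) * \<kappa>\<^sup>2)\<^sup>2 * (1 + 2 * q * (\<kappa>\<^sup>2 + 2 * q * \<kappa> + 2 * q)) * (G\<^sup>2 * W\<^sup>2 / (\<mu> * \<gamma>\<^sup>2))"
    unfolding Asc_def by (simp add: power_mult_distrib power_divide mult_ac)
  have L: "0 < L" using Lge GW by linarith
  have LKle: "LK \<le> (\<kappa>\<^sup>2 + (1 + \<kappa>) * \<kappa> ^ 4 * (2 * q)) * (W / \<gamma>\<^sup>2)"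
  proof -
    have "\<kappa>\<^sup>2 * W / \<gamma> \<le> \<kappa>\<^sup>2 * W / \<gamma>\<^sup>2"
      using \<gamma> \<gamma>1 pos by (intro divide_left_mono) (auto simp: power2_eq_square mult_left_le)
    moreover have "(1 + \<kappa>) * \<kappa> ^ 4 * b * W / \<gamma>\<^sup>2 \<le> (1 + \<kappa>) * \<kappa> ^ 4 * (2 * q) * W / \<gamma>\<^sup>2"
      using \<kappa> pos b by (intro divide_right_mono mult_right_mono mult_left_mono) auto
    ultimately show ?thesis unfolding LK_def by (simp add: distrib_right add_divide_distrib)
  qed
  have LK0: "0 \<le> LK" unfolding LK_def using \<kappa> \<gamma> pos b by (intro add_nonneg_nonneg) auto
  let ?H = "\<kappa>\<^sup>2 + (1 + \<kappa>) * \<kappa> ^ 4 * (2 * q)"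
  have BB: "1 \<le> 1 + L0 * Bp" using L0 Bp by simp
  have "2 * R * T * L * LK / (Asc * dK) = (2 * R * T * \<mu> / dK) * (LK / (L * (1 + L0 * Bp)))"
  proof -
    have "2 * R * T * L * LK / (L\<^sup>2 / \<mu> * E * dK) = (2 * R * T * \<mu> / dK) * (LK / (L * E))" if "0 < E" for E
      using that L pos by (simp add: power2_eq_square field_simps)
    then show ?thesis unfolding Asc_def using BB by simp
  qed
  also have "\<dots> \<le> (2 * R * T * \<mu> / dK) * (?H * (W / \<gamma>\<^sup>2) / (G * W / \<gamma> * 1))"
    using LKle LK0 Lge BB GW pos L by (intro mult_left_mono frac_le mult_mono) auto
  also have "\<dots> = 2 * R * ?H * \<mu> * T / (G * dK * \<gamma>)"
  proof -
    have "?H * (W / \<gamma>\<^sup>2) / (G * W / \<gamma> * 1) = ?H / (G * \<gamma>)"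
      using pos \<gamma> by (simp add: power2_eq_square)
    then show ?thesis by (simp add: mult_ac)
  qed
  finally show "2 * R * T * L * LK / (Asc * dK) \<le> 2 * R * ?H * \<mu> * T / (G * dK * \<gamma>)" .
qed

text \<open>\<open>\<epsilon>\<close>, \<open>N\<close> and \<open>\<eta>\<close> are fixed from the
  parameters and \<open>T\<close>, before costs and disturbances are revealed. The second bound is a
  weakening of the first by \<open>system_bound\<close>.\<close>

lemma tracking_algorithm_regret:
  fixes A B K0 :: "real mat" and \<kappa> \<gamma> W G \<mu> :: real and T :: nat
  assumes dims: "1 \<le> dx" "1 \<le> du" and A: "A \<in> carrier_mat dx dx" and B: "B \<in> carrier_mat dx du"
    and K0: "K0 \<in> carrier_mat du dx"
    and \<kappa>: "1 \<le> \<kappa>" and \<gamma>: "0 < \<gamma>" "\<gamma> < 1" and W: "0 < W" and G: "0 < G" and \<mu>: "0 < \<mu>" and T: "1 \<le> T"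
    and ne: "policy_class A B \<kappa> \<gamma> \<noteq> {}" and fin: "Lambda A B K0 < \<infinity>"
    and dK: "dK = real (du * dx)"
    and RK: "RK = \<kappa> * sqrt (real (min dx du))"
    and L0: "L0 = enn2real (Lambda A B K0)"
    and D: "D = (sqrt (1 + \<kappa>\<^sup>2) + 2 * L0) * (\<kappa>\<^sup>2 * W / \<gamma>)"
    and L: "L = G * D"
    and LK: "LK = \<kappa>\<^sup>2 * W / \<gamma> + (1 + \<kappa>) * \<kappa> ^ 4 * op_norm B * W / \<gamma>\<^sup>2"
    and Asc: "Asc = L\<^sup>2 / \<mu> * (1 + L0 * B_plus A B)"
  shows "\<exists>\<epsilon>>0. \<exists>N. \<exists>\<eta>>0. finite_cover \<epsilon> N (policy_class A B \<kappa> \<gamma>) \<and>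
    (\<forall>c w.
      (\<forall>t\<in>{1..T}. regular_cost (dx + du) G D (c t) \<and>
         strongly_convex_on (dx + du) \<mu> (vball (dx + du) D) (c t)) \<longrightarrow>
      (\<forall>t\<in>{1..T}. w t \<in> vball dx W) \<longrightarrow>
      regret A B (policy_class A B \<kappa> \<gamma>) (tracking_law A B K0 N \<eta> c w) c w T
        \<le> 33 * Asc * dK * ln (4 + 2 * RK * real T * L * LK / (Asc * dK)) \<and>
      (Max {1, Lambda A B K0, Lambda_B A B K0} \<le> 2 * track_complexity A B \<longrightarrow>
        regret A B (policy_class A B \<kappa> \<gamma>) (tracking_law A B K0 N \<eta> c w) c w T
        \<le> system_constant dx du \<kappa> (track_complexity A B) * (G\<^sup>2 * W\<^sup>2 / (\<mu> * \<gamma>\<^sup>2)) * dK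
          * ln (4 + system_constant dx du \<kappa> (track_complexity A B) * \<mu> * real T / (G * dK * \<gamma>))))"
proof -
  interpret benchmark dx du A B \<kappa> \<gamma> W by unfold_locales (fact A B \<kappa> \<gamma> W)+
  have Lam: "Lambda A B K0 = (\<Sum>r. ennreal (op_norm ((1\<^sub>m dx @\<^sub>r (- K0)) * (A - B * K0) ^\<^sub>m r)))"
    using A by (simp add: Lambda_def)
  have part: "(\<Sum>r<m. op_norm ((1\<^sub>m dx @\<^sub>r (- K0)) * (A - B * K0) ^\<^sub>m r)) \<le> L0" for m
    unfolding L0 Lam by (rule partial_sum_le_enn2real) (use fin Lam in auto)
  have L0_nonneg: "0 \<le> L0" by (simp add: L0)
  have Bp: "0 \<le> B_plus A B" by (simp add: B_plus_def)
  have dK0: "0 < dK" using dims by (simp add: dK)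
  have RK0: "0 < RK" using dims \<kappa> by (simp add: RK)
  have T0: "0 < real T" using T by simp
  have X0: "0 < \<kappa>\<^sup>2 * W / \<gamma>" using X_pos by (simp add: X_def)
  have "0 < sqrt (1 + \<kappa>\<^sup>2)" by (simp add: add_pos_nonneg)
  then have D0: "0 < D" unfolding D using X0 L0_nonneg by (intro mult_pos_pos add_pos_nonneg) auto
  have Lpos: "0 < L" using G D0 by (simp add: L)
  have LKeq: "LK = local.LK" unfolding LK LK_def ..
  have LK0: "0 < LK" unfolding LKeq by (rule LK_pos)
  have Asc0: "0 < Asc"
    unfolding Asc using Lpos \<mu> L0_nonneg Bp by (intro mult_pos_pos divide_pos_pos add_pos_nonneg) auto
  \<comment> \<open>With this radius the total discretisation error
    \<open>T * L * LK * \<epsilon>\<close> equals \<open>Asc * dK\<close>, no more than the order of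
    the exponential weights term.\<close>
  define \<epsilon> where "\<epsilon> = Asc * dK / (real T * L * LK)"
  have \<epsilon>: "0 < \<epsilon>" unfolding \<epsilon>_def using Asc0 dK0 T0 Lpos LK0 by simp
  define arg where "arg = 2 * RK * real T * L * LK / (Asc * dK)"
  have arg0: "0 \<le> arg" unfolding arg_def using RK0 T0 Lpos LK0 Asc0 dK0 by simp
  have arg_eq: "2 * (\<kappa> * sqrt (real (min du dx))) / \<epsilon> = arg"
    unfolding arg_def \<epsilon>_def RK by (simp add: min.commute mult_ac)
  obtain N where cover: "finite_cover \<epsilon> N \<K>" and card: "real (card N) \<le> (6 * (1 + arg)) ^ (du * dx)"
    using finite_cover_exists[of \<K> du dx \<kappa> \<epsilon>] policy_classD[OF _ A B] \<kappa> \<epsilon> dims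
    unfolding arg_eq by auto
  have Npos: "0 < card N"
    using cover ne unfolding finite_cover_def by (auto simp: card_gt_0_iff)
  have "ln (real (card N)) \<le> ln ((6 * (1 + arg)) ^ (du * dx))" using card Npos by (intro ln_mono) auto
  also have "\<dots> = dK * ln (6 * (1 + arg))" using arg0 by (simp add: ln_realpow dK)
  also have "\<dots> \<le> dK * (2 * ln (4 + arg))"
    using dK0 ln_cover_size_le(1)[OF arg0] by (intro mult_left_mono) auto
  finally have lnN: "ln (real (card N)) \<le> dK * (2 * ln (4 + arg))" .
  have ell: "1 \<le> ln (4 + arg)" by (rule ln_cover_size_le(2)[OF arg0])
  define \<eta> where "\<eta> = 1 / (16 * Asc)"
  have \<eta>: "0 < \<eta>" using Asc0 by (simp add: \<eta>_def)
  \<comment> \<open>The constant is \<open>33 = 16 * 2 + 1\<close>: 16 from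
    \<open>1 / \<eta>\<close>, 2 from \<open>ln_cover_size_le\<close>, and 1 for the discretisation
    error.\<close>
  have main: "regret A B \<K> (tracking_law A B K0 N \<eta> c w) c w T \<le> 33 * Asc * dK * ln (4 + arg)"
    if c: "\<forall>t\<in>{1..T}. regular_cost (dx + du) G D (c t) \<and>
         strongly_convex_on (dx + du) \<mu> (vball (dx + du) D) (c t)"
      and w: "\<forall>t\<in>{1..T}. w t \<in> vball dx W" for c w
  proof -
    have "regret A B \<K> (tracking_law A B K0 N \<eta> c w) c w T \<le> 16 * Asc * ln (real (card N)) + real T * L * LK * \<epsilon>"
      unfolding \<eta>_def Asc LKeq L D X_def[symmetric]
      by (rule cover_tracking_regret[OF K0 part ne cover \<epsilon> G \<mu>])
        (use c w in \<open>simp_all add: D X_def\<close>)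
    also have "real T * L * LK * \<epsilon> = Asc * dK * 1"
      unfolding \<epsilon>_def using T0 Lpos LK0 by simp
    also have "16 * Asc * ln (real (card N)) + Asc * dK * 1 \<le> 16 * Asc * (dK * (2 * ln (4 + arg))) + Asc * dK * ln (4 + arg)"
      using lnN ell Asc0 dK0 by (intro add_mono mult_left_mono) auto
    also have "\<dots> = 33 * Asc * dK * ln (4 + arg)" by simp
    finally show ?thesis .
  qed
  define \<CC> where "\<CC> = track_complexity A B"
  define Cs where "Cs = system_constant dx du \<kappa> \<CC>"
  have sys: "33 * Asc * dK * ln (4 + arg)
      \<le> Cs * (G\<^sup>2 * W\<^sup>2 / (\<mu> * \<gamma>\<^sup>2)) * dK * ln (4 + Cs * \<mu> * real T / (G * dK * \<gamma>))"
    if opt: "Max {1, Lambda A B K0, Lambda_B A B K0} \<le> 2 * \<CC>"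
  proof -
    define q where "q = enn2real \<CC>"
    define a where "a = (sqrt (1 + \<kappa>\<^sup>2) + 4 * q) * \<kappa>\<^sup>2"
    have fin\<CC>: "\<CC> < \<infinity>" unfolding \<CC>_def by (rule track_complexity_finite[OF A B K0 dims(1) fin])
    have q2: "enn2real y \<le> 2 * q" if "y \<le> 2 * \<CC>" for y
    proof -
      have "enn2real y \<le> enn2real (2 * \<CC>)"
        by (rule enn2real_mono[OF that]) (use fin\<CC> in \<open>simp add: ennreal_mult_less_top\<close>)
      then show ?thesis by (simp add: enn2real_mult q_def)
    qed
    have L0q: "L0 \<le> 2 * q" unfolding L0 by (rule q2) (use opt in simp)
    have "ennreal (op_norm B) \<le> 2 * \<CC>"
      using op_norm_input_le_Lambda_B[OF A B K0] opt by (auto intro: order_trans)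
    from q2[OF this] have bq: "op_norm B \<le> 2 * q" by simp
    obtain K where K: "K \<in> \<K>" using ne by blast
    have Bpb: "B_plus A B \<le> \<kappa>\<^sup>2 + op_norm B * \<kappa> + op_norm B"
      using B_plus_le[OF A B] op_norm_state_matrix_le[OF A B K \<gamma> \<kappa>] by linarith
    note bounds = system_bound[of \<kappa> \<gamma> W G \<mu> dK "real T" RK L0 q "op_norm B" "B_plus A B",
        OF \<kappa> \<gamma>(1) W G \<mu> dK0 less_imp_le[OF T0] less_imp_le[OF RK0] L0_nonneg L0q op_norm_nonneg bq Bp Bpb \<gamma>(2),
        folded D, folded L, folded Asc LK a_def]
    let ?P = "G\<^sup>2 * W\<^sup>2 / (\<mu> * \<gamma>\<^sup>2)"
    have P: "0 < ?P" using G W \<mu> \<gamma> by simp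
    have Cs: "33 * (a\<^sup>2 * (1 + 2 * q * (\<kappa>\<^sup>2 + 2 * q * \<kappa> + 2 * q))) \<le> Cs"
      "2 * RK * (\<kappa>\<^sup>2 + (1 + \<kappa>) * \<kappa> ^ 4 * (2 * q)) \<le> Cs"
      unfolding Cs_def RK by (rule system_constant_ge[OF q_def a_def])+
    have Cs0: "0 < Cs" unfolding Cs_def by (rule system_constant_pos)
    have "33 * Asc \<le> 33 * (a\<^sup>2 * (1 + 2 * q * (\<kappa>\<^sup>2 + 2 * q * \<kappa> + 2 * q))) * ?P"
      using bounds(1) by simp
    also have "\<dots> \<le> Cs * ?P" using Cs(1) P by (intro mult_right_mono) auto
    finally have AscP: "33 * Asc \<le> Cs * ?P" .
    have "arg \<le> (2 * RK * (\<kappa>\<^sup>2 + (1 + \<kappa>) * \<kappa> ^ 4 * (2 * q))) * \<mu> * real T / (G * dK * \<gamma>)"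
      unfolding arg_def using bounds(2) .
    also have "\<dots> \<le> Cs * \<mu> * real T / (G * dK * \<gamma>)"
      using Cs(2) \<mu> T0 G dK0 \<gamma> by (intro divide_right_mono mult_right_mono) auto
    finally have "ln (4 + arg) \<le> ln (4 + Cs * \<mu> * real T / (G * dK * \<gamma>))"
      using arg0 by (intro ln_mono) auto
    then show ?thesis
      by (rule mult_mono[OF mult_right_mono[OF AscP less_imp_le[OF dK0]]])
        (use less_imp_le[OF mult_pos_pos[OF mult_pos_pos[OF Cs0 P] dK0]] ell in auto)
  qed
  show ?thesis
    using \<epsilon> cover \<eta> main order_trans[OF main sys]
    unfolding arg_def[symmetric] \<CC>_def Cs_def by blast
qed

theorem theorem6p2:
  shows "\<exists>C>0. \<exists>Csys :: nat \<Rightarrow> nat \<Rightarrow> real \<Rightarrow> ennreal \<Rightarrow> real.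
    (\<forall>dx du \<kappa> \<CC>. 0 < Csys dx du \<kappa> \<CC>) \<and>
    (\<forall>(dx::nat) (du::nat) A B K0 (\<kappa>::real) (\<gamma>::real) (W::real) (G::real) (\<mu>::real) (T::nat).
      1 \<le> dx \<longrightarrow> 1 \<le> du \<longrightarrow>
      A \<in> carrier_mat dx dx \<longrightarrow> B \<in> carrier_mat dx du \<longrightarrow> K0 \<in> carrier_mat du dx \<longrightarrow>
      1 \<le> \<kappa> \<longrightarrow> 0 < \<gamma> \<longrightarrow> \<gamma> < 1 \<longrightarrow> 0 < W \<longrightarrow> 0 < G \<longrightarrow> 0 < \<mu> \<longrightarrow> 1 \<le> T \<longrightarrow>
      policy_class A B \<kappa> \<gamma> \<noteq> {} \<longrightarrow>
      Lambda A B K0 < \<infinity> \<longrightarrow>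
      (let dK = real (du * dx);
           RK = \<kappa> * sqrt (real (min dx du));
           L0 = enn2real (Lambda A B K0);
           X = \<kappa>\<^sup>2 * W / \<gamma>;
           D = (sqrt (1 + \<kappa>\<^sup>2) + 2 * L0) * X;
           L = G * D;
           LK = \<kappa>\<^sup>2 * W / \<gamma> + (1 + \<kappa>) * \<kappa> ^ 4 * op_norm B * W / \<gamma>\<^sup>2;
           Asc = L\<^sup>2 / \<mu> * (1 + L0 * B_plus A B)
       in \<exists>\<epsilon>>0. \<exists>N. \<exists>\<eta>>0. finite_cover \<epsilon> N (policy_class A B \<kappa> \<gamma>) \<and>
            (\<forall>c w.
              (\<forall>t\<in>{1..T}. regular_cost (dx + du) G D (c t) \<and>
                 strongly_convex_on (dx + du) \<mu> (vball (dx + du) D) (c t)) \<longrightarrow>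
              (\<forall>t\<in>{1..T}. w t \<in> vball dx W) \<longrightarrow>
              (let Reg = regret A B (policy_class A B \<kappa> \<gamma>) (tracking_law A B K0 N \<eta> c w) c w T;
                   \<CC> = track_complexity A B;
                   Cs = Csys dx du \<kappa> \<CC>
               in Reg \<le> C * Asc * dK * ln (4 + 2 * RK * real T * L * LK / (Asc * dK)) \<and>
                  (Max {1, Lambda A B K0, Lambda_B A B K0} \<le> 2 * \<CC> \<longrightarrow>
                     Reg \<le> Cs * (G\<^sup>2 * W\<^sup>2 / (\<mu> * \<gamma>\<^sup>2)) * dK
                              * ln (4 + Cs * \<mu> * real T / (G * dK * \<gamma>)))))))"
  unfolding Let_def
  by (rule exI[of _ 33], rule conjI, simp, rule exI[of _ system_constant], intro conjI allI impI,
      rule system_constant_pos, rule tracking_algorithm_regret, (assumption | rule refl)+)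

end
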